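(* Let $p$ be an odd prime, $r\ge1$, $q=p^r$, and let $C$ be the curve $y^q-y=x^{q+1}-x^2$ over $\mathbb F_q$. Let $w$ be a primitive complex $p$-th root of unity, and let $i$ be a primitive complex $4$-th root of unity. Let $\eta_1,\dots,\eta_{q(q-1)}$ be the reciprocal roots of the $L$-polynomial $L_C(T)$ of $C$ over $\mathbb F_q$, and let $\zeta_j=\eta_j/\sqrt q$. Then the $\zeta_j$, with multiplicities, are as follows. (1) When $q$ is a square: - $1$ with multiplicity $\left(\frac qp-\sqrt q\,\frac{p-1}{p}\right)\left(\frac{q-1}{2}\right)$, - $-1$ with multiplicity $\left(\frac qp+\sqrt q\,\frac{p-1}{p}\right)\left(\frac{q-1}{2}\right)$, - $w^k$ with multiplicity $\left(\frac qp+\frac{\sqrt q}{p}\right)\left(\frac{q-1}{2}\right)$, - $-w^k$ with multiplicity $\left(\frac qp-\frac{\sqrt q}{p}\right)\left(\frac{q-1}{2}\right)$, for $1\le k\le p-1$. (2) When $q\equiv 1\pmod 4$ and $q$ is not a square: - $1$ with multiplicity $\left(\frac qp\right)\left(\frac{q-1}{2}\right)$, - $-1$ with multiplicity $\left(\frac qp\right)\left(\frac{q-1}{2}\right)$, - $w^k$ with multiplicity $\left(\frac qp-\left(\frac kp\right)\sqrt{\frac qp}\right)\left(\frac{q-1}{2}\right)$, - $-w^k$ with multiplicity $\left(\frac qp+\left(\frac kp\right)\sqrt{\frac qp}\right)\left(\frac{q-1}{2}\right)$, for $1\le k\le p-1$. (3) When $q\equiv 3\pmod 4$: - $i$ with multiplicity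 $\left(\frac qp\right)\left(\frac{q-1}{2}\right)$, - $-i$ with multiplicity $\left(\frac qp\right)\left(\frac{q-1}{2}\right)$, - $iw^k$ with multiplicity $\left(\frac qp+\left(\frac kp\right)\sqrt{\frac qp}\right)\left(\frac{q-1}{2}\right)$, - $-iw^k$ with multiplicity $\left(\frac qp-\left(\frac kp\right)\sqrt{\frac qp}\right)\left(\frac{q-1}{2}\right)$, for $1\le k\le p-1$. Here $\left(\frac kp\right)$ denotes the Legendre symbol, while $\frac qp$ is the ordinary quotient of $q$ by $p$.
   Context: $C$ denotes the smooth projective curve over $\mathbb F_q$ with affine equation $y^q-y=x^{q+1}-x^2$; it has genus $g=q(q-1)/2$. Its $L$-polynomial over $\mathbb F_q$ is $L_C(T)=\exp\left(\sum_{n\ge1}(\#C(\mathbb F_{q^n})-q^n-1)\frac{T^n}{n}\right)$, a polynomial of degree $2g$ with integer coefficients and constant term $1$, where $\#C(\mathbb F_{q^n})$ is the number of $\mathbb F_{q^n}$-rational points of $C$. Its reciprocal roots $\eta_1,\dots,\eta_{2g}$ are defined by $L_C(T)=\prod_{j=1}^{2g}(1-\eta_jT)$, so that $\#C(\mathbb F_{q^n})=q^n+1-\sum_j\eta_j^n$.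
   Formalization: In (2) and (3) w and i cannot be arbitrary primitive roots (q=3, w=e^{4πI/3}, i=I fails, I=√−1): (2) is stated for w=e^{2πIa/p} with (a/p)=1, and (3) for w=e^{2πIa/p}, i=(a/p)I, which are exactly the choices for which the formulas hold. *)

theory Defs
  imports
    "HOL-Analysis.Analysis"
    "HOL-Computational_Algebra.Computational_Algebra"
    "HOL-Number_Theory.Number_Theory"
begin

(* The field with m elements inside an algebraically closed field of characteristic p,
   for m a positive power of p. *)
definition GF :: "nat \<Rightarrow> 'k :: alg_closed_field set" where
  "GF m = {x. x ^ m = x}"

(* The point (x : y : z) of the projective plane over the subfield K, as a set of
   homogeneous coordinate triples. *)
definition proj_point :: "'k :: field set \<Rightarrow> 'k \<times> 'k \<times> 'k \<Rightarrow> ('k \<times> 'k \<times> 'k) set" where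
  "proj_point K = (\<lambda>(x, y, z). {(c * x, c * y, c * z) | c. c \<in> K - {0}})"

(* C is the projective closure of y^q - y = x^(q+1) - x^2 in the plane.  For q a power of the
   odd characteristic it is smooth: let F = y^q z - y z^q - x^(q+1) + x^2 z^(q-1).  Then
   dF/dy = -z^q, so a singular point has z = 0, hence x = 0 by the equation, but there
   dF/dz = y^q is nonzero.  A smooth plane curve of degree q + 1 has genus q (q - 1) / 2. *)
definition C_points :: "nat \<Rightarrow> nat \<Rightarrow> ('k :: alg_closed_field \<times> 'k \<times> 'k) set set" where
  "C_points q n = proj_point (GF (q ^ n)) `
     {(x, y, z). x \<in> GF (q ^ n) \<and> y \<in> GF (q ^ n) \<and> z \<in> GF (q ^ n) \<and>
        (x, y, z) \<noteq> (0, 0, 0) \<and>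
        y ^ q * z - y * z ^ q = x ^ (q + 1) - x ^ 2 * z ^ (q - 1)}"

(* The type argument is the algebraically closed field in which the points of C are taken. *)
definition L_C :: "'k :: alg_closed_field itself \<Rightarrow> nat \<Rightarrow> complex fps" where
  "L_C _ q = fps_exp 1 oo
     Abs_fps (\<lambda>n. if n = 0 then 0
       else (of_nat (card (C_points q n :: ('k \<times> 'k \<times> 'k) set set)) - of_nat q ^ n - 1) / of_nat n)"

definition primitive_root_of_unity :: "nat \<Rightarrow> complex \<Rightarrow> bool" where
  "primitive_root_of_unity n z \<longleftrightarrow> n > 0 \<and> z ^ n = 1 \<and> (\<forall>m. 0 < m \<and> m < n \<longrightarrow> z ^ m \<noteq> 1)"

definition mult_in :: "(nat \<Rightarrow> complex) \<Rightarrow> nat \<Rightarrow> complex \<Rightarrow> real" where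
  "mult_in \<zeta> N z = real (card {j \<in> {1..N}. \<zeta> j = z})"

end

theory Submission
  imports Defs
begin

text \<open>
  Let \<open>\<psi>\<close> be the additive character of \<open>GF q\<close> that sends \<open>x\<close> to \<open>w\<close> raised to the absolute trace
  of \<open>x\<close>. Additive Hilbert 90, together with
  \<open>Tr (x^(q+1) - x^2) = - Tr ((x^q - x)^2) / 2\<close>, writes the number of points over \<open>GF (q^n)\<close> as
  \<open>q^n + 1\<close> plus the sum over \<open>c \<noteq> 0\<close> and \<open>b\<close> in \<open>GF q\<close> of the exponential sums
  \<open>\<Sum>u. \<psi> (c * Tr (u^2) + b * Tr u)\<close>. These satisfy a Hasse--Davenport relation: the L-function of the
  multiplicative function \<open>f \<mapsto> \<psi> (c * p2 f + b * p1 f)\<close> on monic polynomials over \<open>GF q\<close>, where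
  \<open>p1\<close>, \<open>p2\<close> are the first two power sums of the roots, is a polynomial of degree 1 in \<open>T\<close>.
  So the reciprocal roots are the sums \<open>- (\<Sum>t. \<psi> (c * t^2 + b * t))\<close>, which are
  \<open>- \<chi> c * G * \<psi> (- c * b^2)\<close> after replacing \<open>b\<close> by \<open>2 * c * b\<close> and completing the square, with
  \<open>\<chi>\<close> the quadratic character and \<open>G\<close> the quadratic Gauss sum of \<open>GF q\<close>. The same relation over
  the prime field reduces \<open>G\<close> to the Gauss sum modulo \<open>p\<close>, whose sign is found by Gauss's
  q-binomial identity; the multiplicities follow by orthogonality of characters.
\<close>

hide_const (open) Coset.order Module.smult UnivPoly.monom UnivPoly.coeff

lemma order_prod_mset_linear:
  fixes A :: "'a :: idom multiset"
  shows "order x (\<Prod>y\<in>#A. [:- y, 1:]) = count A x"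
proof (induction A)
  case (add y A)
  have nz: "(\<Prod>y\<in>#A. [:- y, 1:]) \<noteq> 0"
    by (auto simp: prod_mset_zero_iff)
  have "order x [:- y, 1:] = (if x = y then 1 else 0)"
    using order_power_n_n[of y 1] by (auto intro: order_0I)
  thus ?case
    using add order_mult[of "[:- y, 1:]" "\<Prod>y\<in>#A. [:- y, 1:]" x] nz
    by (simp del: mult_pCons_left)
qed (simp add: order_0I)

lemma alg_closed_factorization_order:
  fixes f :: "'a :: alg_closed_field poly"
  assumes "f \<noteq> 0"
  obtains A where "size A = degree f" "f = smult (lead_coeff f) (\<Prod>x\<in>#A. [:- x, 1:])"
    "\<And>x. order x f = count A x"
proof -
  obtain A where A: "size A = degree f" "f = smult (lead_coeff f) (\<Prod>x\<in>#A. [:- x, 1:])"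
    using alg_closed_imp_factorization[OF assms] by blast
  have "order x f = count A x" for x
    using assms by (subst A(2)) (simp add: order_smult order_prod_mset_linear)
  with A that show thesis by blast
qed

lemma degree_eq_sum_order:
  fixes f :: "'a :: alg_closed_field poly"
  assumes "f \<noteq> 0"
  shows "degree f = (\<Sum>x | poly f x = 0. order x f)"
proof -
  obtain A where A: "size A = degree f" "\<And>x. order x f = count A x"
    using alg_closed_factorization_order[OF assms] by metis
  have "set_mset A = {x. poly f x = 0}"
    using A(2) assms by (auto simp: order_root count_greater_zero_iff[symmetric] simp del: count_greater_zero_iff)
  thus ?thesis using A by (simp add: size_multiset_overloaded_eq)
qed

lemma dvd_if_order_le:
  fixes f g :: "'a :: alg_closed_field poly"
  assumes "f \<noteq> 0" "\<And>x. order x f \<le> order x g"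
  shows "f dvd g"
proof (cases "g = 0")
  case False
  obtain A where A: "f = smult (lead_coeff f) (\<Prod>x\<in>#A. [:- x, 1:])" "\<And>x. order x f = count A x"
    using alg_closed_factorization_order[OF assms(1)] by metis
  obtain B where B: "g = smult (lead_coeff g) (\<Prod>x\<in>#B. [:- x, 1:])" "\<And>x. order x g = count B x"
    using alg_closed_factorization_order[OF False] by metis
  have "A \<subseteq># B"
    using assms(2) A(2) B(2) by (simp add: subseteq_mset_def)
  hence "(\<Prod>x\<in>#A. [:- x, 1:]) dvd (\<Prod>x\<in>#B. [:- x, 1:])"
    by (intro prod_mset_subset_imp_dvd image_mset_subseteq_mono)
  thus ?thesis
    using assms(1) by (subst A(1), subst B(1)) (simp add: smult_dvd_iff dvd_smult)
qed auto

lemma order_eq_1_if_simple_root: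
  fixes f :: "'a :: field poly"
  assumes "poly f a = 0" "poly (pderiv f) a \<noteq> 0"
  shows "order a f = 1"
proof -
  have f: "f \<noteq> 0" using assms by auto
  hence "order a f \<noteq> 0" using assms by (auto simp: order_root)
  moreover have "\<not> order a f \<ge> 2"
  proof
    assume "order a f \<ge> 2"
    hence "[:- a, 1:] ^ 2 dvd f" using f by (simp add: order_divides)
    then obtain g where g: "f = [:- a, 1:] ^ 2 * g" by (elim dvdE)
    have "poly (pderiv f) a = 0"
      by (simp add: g pderiv_mult power2_eq_square pderiv_pCons del: mult_pCons_left)
    with assms show False by simp
  qed
  ultimately show ?thesis by linarith
qed

locale frobenius =
  fixes q s :: nat and ty :: "'k :: alg_closed_field itself"
  assumes prime_char: "prime CHAR('k)"
    and q_eq: "q = CHAR('k) ^ s"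
    and s_pos: "s > 0"
begin

lemma q_gt_1: "q > 1"
  unfolding q_eq using prime_gt_1_nat[OF prime_char] s_pos by (rule one_less_power)

lemma q_pow_char: "q ^ n = CHAR('k) ^ (s * n)"
  by (simp add: q_eq power_mult)

lemma frob_add: "(x + y :: 'k) ^ q ^ n = x ^ q ^ n + y ^ q ^ n"
  using freshmans_dream'[OF prime_char q_pow_char] .

lemma frob_sum: "(sum f A :: 'k) ^ q ^ n = (\<Sum>x\<in>A. f x ^ q ^ n)"
  using freshmans_dream_sum'[OF prime_char q_pow_char] .

lemma frob_0: "(0 :: 'k) ^ q ^ n = 0"
  using q_gt_1 by simp

lemma frob_minus: "(- x :: 'k) ^ q ^ n = - (x ^ q ^ n)"
  using frob_add[of x "- x" n] frob_0[of n] by (simp add: eq_neg_iff_add_eq_0 add.commute)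

lemma frob_diff: "(x - y :: 'k) ^ q ^ n = x ^ q ^ n - y ^ q ^ n"
  using frob_add[of x "- y" n] by (simp add: frob_minus)

lemma frob_inj: "(x :: 'k) ^ q ^ n = y ^ q ^ n \<Longrightarrow> x = y"
  using frob_diff[of x y n] by simp

lemma frob_pow_pow: "((x :: 'k) ^ q ^ m) ^ q ^ n = x ^ q ^ (m + n)"
  by (simp add: power_mult[symmetric] power_add)

lemma GF_add: "x \<in> GF (q ^ n) \<Longrightarrow> y \<in> GF (q ^ n) \<Longrightarrow> (x + y :: 'k) \<in> GF (q ^ n)"
  by (simp add: GF_def frob_add)

lemma GF_diff: "x \<in> GF (q ^ n) \<Longrightarrow> y \<in> GF (q ^ n) \<Longrightarrow> (x - y :: 'k) \<in> GF (q ^ n)"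
  by (simp add: GF_def frob_diff)

lemma GF_minus: "x \<in> GF (q ^ n) \<Longrightarrow> (- x :: 'k) \<in> GF (q ^ n)"
  by (simp add: GF_def frob_minus)

lemma GF_sum: "(\<And>x. x \<in> A \<Longrightarrow> f x \<in> GF (q ^ n)) \<Longrightarrow> (sum f A :: 'k) \<in> GF (q ^ n)"
  by (simp add: GF_def frob_sum)

lemma GF_0: "(0 :: 'k) \<in> GF (q ^ n)"
  by (simp add: GF_def frob_0)

lemma GF_1: "(1 :: 'k) \<in> GF m"
  by (simp add: GF_def)

lemma GF_mult: "x \<in> GF m \<Longrightarrow> y \<in> GF m \<Longrightarrow> (x * y :: 'k) \<in> GF m"
  by (simp add: GF_def power_mult_distrib)

lemma GF_power: "x \<in> GF m \<Longrightarrow> (x ^ j :: 'k) \<in> GF m"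
  unfolding GF_def by (metis (mono_tags, lifting) mem_Collect_eq power_commutes power_mult mult.commute)

lemma GF_divide: "x \<in> GF m \<Longrightarrow> y \<in> GF m \<Longrightarrow> (x / y :: 'k) \<in> GF m"
  by (simp add: GF_def power_divide)

lemma GF_of_nat: "(of_nat m :: 'k) \<in> GF (q ^ n)"
  by (induction m) (auto intro: GF_0 GF_1 GF_add)

lemma artin_schreier_roots:
  assumes "n > 0"
  shows "finite {y :: 'k. y ^ q ^ n - y = v}"
    and "card {y :: 'k. y ^ q ^ n - y = v} = q ^ n"
proof -
  define m where "m = q ^ n"
  have m: "m > 1" unfolding m_def using q_gt_1 assms by (rule one_less_power)
  have m0: "(of_nat m :: 'k) = 0"
    using assms s_pos by (simp add: m_def q_eq)
  define f :: "'k poly" where "f = monom 1 m + [:- v, - 1:]"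
  have cf: "coeff f m = 1"
    using m by (auto simp: f_def coeff_pCons split: nat.splits)
  have f: "f \<noteq> 0" using cf by auto
  have deg: "degree f = m"
    unfolding f_def using m by (subst degree_add_eq_left) (auto simp: degree_monom_eq)
  have root: "poly f y = 0 \<longleftrightarrow> y ^ m - y = v" for y
    by (auto simp: f_def poly_monom algebra_simps)
  have "pderiv f = - 1"
    by (simp add: f_def pderiv_add pderiv_monom m0 pderiv_pCons one_pCons)
  hence "order y f = 1" if "poly f y = 0" for y
    using that by (intro order_eq_1_if_simple_root) auto
  hence "m = (\<Sum>y | poly f y = 0. 1)"
    using degree_eq_sum_order[OF f] deg by simp
  thus "card {y :: 'k. y ^ q ^ n - y = v} = q ^ n"
    using root by (simp add: m_def)
  show "finite {y :: 'k. y ^ q ^ n - y = v}"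
    using poly_roots_finite[OF f] root by (simp add: m_def)
qed

lemma finite_GF: "n > 0 \<Longrightarrow> finite (GF (q ^ n) :: 'k set)"
  and card_GF: "n > 0 \<Longrightarrow> card (GF (q ^ n) :: 'k set) = q ^ n"
  using artin_schreier_roots[of n 0] by (simp_all add: GF_def)

end

section \<open>Frobenius-invariant polynomials\<close>

context frobenius
begin

lemma GF_q_closed:
  shows "x \<in> GF q \<Longrightarrow> y \<in> GF q \<Longrightarrow> (x + y :: 'k) \<in> GF q"
    and "x \<in> GF q \<Longrightarrow> y \<in> GF q \<Longrightarrow> (x - y :: 'k) \<in> GF q"
    and "x \<in> GF q \<Longrightarrow> (- x :: 'k) \<in> GF q"
    and "(\<And>i. i \<in> A \<Longrightarrow> f i \<in> GF q) \<Longrightarrow> (sum f A :: 'k) \<in> GF q"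
    and "(0 :: 'k) \<in> GF q"
    and "(of_nat m :: 'k) \<in> GF q"
  using GF_add[of _ 1] GF_diff[of _ 1] GF_minus[of _ 1] GF_sum[of A f 1] GF_0[of 1]
    GF_of_nat[of _ 1]
  by simp_all

lemma finite_GF_q: "finite (GF q :: 'k set)"
  and card_GF_q: "card (GF q :: 'k set) = q"
  using finite_GF[of 1] card_GF[of 1] by simp_all

definition frob_poly :: "'k poly \<Rightarrow> 'k poly" where
  "frob_poly f = map_poly (\<lambda>x. x ^ q) f"

lemma coeff_frob_poly: "coeff (frob_poly f) i = coeff f i ^ q"
  using q_gt_1 by (simp add: frob_poly_def coeff_map_poly)

lemma frob_poly_mult: "frob_poly (f * g) = frob_poly f * frob_poly g"
  by (intro poly_eqI)
     (simp add: coeff_frob_poly coeff_mult power_mult_distrib frob_sum[of _ _ 1, simplified])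

lemma frob_poly_1: "frob_poly 1 = 1"
  using q_gt_1 by (intro poly_eqI) (auto simp: coeff_frob_poly coeff_1)

lemma frob_poly_prod: "frob_poly (prod g A) = (\<Prod>i\<in>A. frob_poly (g i))"
  by (induction A rule: infinite_finite_induct) (auto simp: frob_poly_mult frob_poly_1)

lemma frob_poly_power: "frob_poly (f ^ n) = frob_poly f ^ n"
  by (induction n) (auto simp: frob_poly_mult frob_poly_1)

lemma frob_poly_linear: "frob_poly [:- a, 1:] = [:- (a ^ q), 1:]"
  using q_gt_1 frob_minus[of a 1]
  by (intro poly_eqI) (auto simp: coeff_frob_poly coeff_pCons split: nat.splits)

definition monic_polys :: "nat \<Rightarrow> 'k poly set" where
  "monic_polys n = {f. degree f = n \<and> lead_coeff f = 1 \<and> frob_poly f = f}"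

lemma frob_poly_eq_iff: "frob_poly f = f \<longleftrightarrow> (\<forall>i. coeff f i \<in> GF q)"
  by (auto simp: poly_eq_iff coeff_frob_poly GF_def)

lemma monic_polys_nonzero: "f \<in> monic_polys n \<Longrightarrow> f \<noteq> 0"
  by (auto simp: monic_polys_def)

lemma finite_monic_polys: "finite (monic_polys n)"
proof (rule finite_subset)
  show "monic_polys n \<subseteq> Poly ` {xs. set xs \<subseteq> GF q \<and> length xs = Suc n}"
  proof
    fix f assume f: "f \<in> monic_polys n"
    hence "f \<noteq> 0" by (rule monic_polys_nonzero)
    hence "length (coeffs f) = Suc n" using f by (simp add: monic_polys_def length_coeffs)
    moreover have "set (coeffs f) \<subseteq> GF q"
      using f by (auto simp: monic_polys_def frob_poly_eq_iff coeffs_def)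
    ultimately show "f \<in> Poly ` {xs. set xs \<subseteq> GF q \<and> length xs = Suc n}"
      by (intro image_eqI[of _ _ "coeffs f"]) auto
  qed
  show "finite (Poly ` {xs. set xs \<subseteq> (GF q :: 'k set) \<and> length xs = Suc n})"
    by (intro finite_imageI finite_lists_length_eq finite_GF_q)
qed

lemma monic_polys_mult:
  "f \<in> monic_polys m \<Longrightarrow> g \<in> monic_polys n \<Longrightarrow> f * g \<in> monic_polys (m + n)"
  using monic_polys_nonzero[of f m] monic_polys_nonzero[of g n]
  by (auto simp: monic_polys_def degree_mult_eq lead_coeff_mult frob_poly_mult coeff_mult_degree_sum)

lemma monic_polys_mult_cancel:
  assumes "f \<in> monic_polys m" "f * g \<in> monic_polys (m + n)"
  shows "g \<in> monic_polys n"
proof -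
  have nz: "f \<noteq> 0" "f * g \<noteq> 0"
    using assms by (auto dest: monic_polys_nonzero)
  hence "g \<noteq> 0" by auto
  have "f * frob_poly g = f * g"
    using assms by (simp add: monic_polys_def frob_poly_mult)
  hence "frob_poly g = g"
    using nz by simp
  moreover have "degree g = n"
    using assms nz \<open>g \<noteq> 0\<close> by (simp add: monic_polys_def degree_mult_eq)
  moreover have "lead_coeff f * lead_coeff g = lead_coeff (f * g)"
    by (simp add: lead_coeff_mult)
  hence "lead_coeff g = 1"
    using assms unfolding monic_polys_def by (metis (mono_tags, lifting) mem_Collect_eq mult_1)
  ultimately show ?thesis by (simp add: monic_polys_def)
qed

definition psum1 :: "'k poly \<Rightarrow> 'k" where
  "psum1 f = - coeff (reflect_poly f) 1"

definition psum2 :: "'k poly \<Rightarrow> 'k" where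
  "psum2 f = coeff (reflect_poly f) 1 ^ 2 - 2 * coeff (reflect_poly f) 2"

lemma psum_mult:
  assumes "lead_coeff f = 1" "lead_coeff g = 1"
  shows "psum1 (f * g) = psum1 f + psum1 g" "psum2 (f * g) = psum2 f + psum2 g"
proof -
  have 0: "coeff (reflect_poly f) 0 = 1" "coeff (reflect_poly g) 0 = 1"
    using assms by simp_all
  have 1: "coeff (reflect_poly (f * g)) 1 = coeff (reflect_poly f) 1 + coeff (reflect_poly g) 1"
    using 0 by (simp add: reflect_poly_mult coeff_mult del: coeff_0_reflect_poly)
  have 2: "coeff (reflect_poly (f * g)) 2 = coeff (reflect_poly f) 2 +
      coeff (reflect_poly f) 1 * coeff (reflect_poly g) 1 + coeff (reflect_poly g) 2"
    using 0 by (simp add: reflect_poly_mult coeff_mult numeral_2_eq_2 algebra_simps del: coeff_0_reflect_poly)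
  show "psum1 (f * g) = psum1 f + psum1 g"
    unfolding psum1_def 1 by simp
  show "psum2 (f * g) = psum2 f + psum2 g"
    unfolding psum2_def 1 2 by (simp add: power2_eq_square algebra_simps)
qed

lemma psum_1: "psum1 1 = 0" "psum2 1 = 0"
  by (simp_all add: psum1_def psum2_def)

lemma psum_linear: "psum1 [:- a, 1:] = a" "psum2 [:- a, 1:] = a ^ 2"
  by (simp_all add: psum1_def psum2_def coeff_reflect_poly)

lemma psum_in_GF:
  assumes "f \<in> monic_polys n"
  shows "psum1 f \<in> GF q" "psum2 f \<in> GF q"
proof -
  have "coeff (reflect_poly f) i \<in> GF q" for i
    using assms GF_q_closed by (simp add: coeff_reflect_poly monic_polys_def frob_poly_eq_iff)
  moreover have "(2 :: 'k) \<in> GF q"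
    using GF_q_closed(6)[of 2] by simp
  ultimately show "psum1 f \<in> GF q" "psum2 f \<in> GF q"
    unfolding psum1_def psum2_def by (auto intro!: GF_q_closed(2,3) GF_mult GF_power)
qed

definition tr :: "nat \<Rightarrow> 'k \<Rightarrow> 'k" where
  "tr k x = (\<Sum>i<k. x ^ q ^ i)"

definition orbit_poly :: "'k \<Rightarrow> nat \<Rightarrow> 'k poly" where
  "orbit_poly a k = (\<Prod>i<k. [:- (a ^ q ^ i), 1:])"

lemma lead_coeff_prod_linear: "lead_coeff (\<Prod>i\<in>A. [:- f i, 1 :: 'k:]) = 1"
  by (induction A rule: infinite_finite_induct) (auto simp: lead_coeff_mult simp del: mult_pCons_left)

lemma orbit_poly_nonzero: "orbit_poly a k \<noteq> 0"
  by (auto simp: orbit_poly_def)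

lemma degree_orbit_poly: "degree (orbit_poly a k) = k"
  unfolding orbit_poly_def by (subst degree_prod_eq_sum_degree) auto

lemma orbit_poly_in_monic_polys:
  assumes "a \<in> GF (q ^ k)"
  shows "orbit_poly a k \<in> monic_polys k"
proof -
  have "frob_poly (orbit_poly a k) = (\<Prod>i<k. [:- (a ^ q ^ Suc i), 1:])"
    unfolding orbit_poly_def frob_poly_prod
    by (intro prod.cong refl, subst frob_poly_linear)
       (simp add: power_mult[symmetric] mult.commute)
  also have "\<dots> = orbit_poly a k"
  proof (cases k)
    case (Suc m)
    have "a ^ q ^ Suc m = a" using assms Suc by (simp add: GF_def)
    thus ?thesis
      unfolding orbit_poly_def Suc
      by (subst prod.lessThan_Suc, subst prod.lessThan_Suc_shift) (simp del: mult_pCons_left mult_pCons_right power_Suc)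
  qed (simp add: orbit_poly_def)
  finally show ?thesis
    using degree_orbit_poly[of a k] lead_coeff_prod_linear[of "\<lambda>i. a ^ q ^ i" "{..<k}"]
    by (simp add: monic_polys_def orbit_poly_def)
qed

lemma psum_orbit_poly: "psum1 (orbit_poly a k) = tr k a" "psum2 (orbit_poly a k) = tr k (a ^ 2)"
proof -
  have "psum1 (\<Prod>i<k. [:- (a ^ q ^ i), 1:]) = (\<Sum>i<k. a ^ q ^ i) \<and>
        psum2 (\<Prod>i<k. [:- (a ^ q ^ i), 1:]) = (\<Sum>i<k. (a ^ q ^ i) ^ 2)"
  proof (induction k)
    case (Suc k)
    note m = psum_mult[OF lead_coeff_prod_linear[of "\<lambda>i. a ^ q ^ i" "{..<k}"], of "[:- (a ^ q ^ k), 1:]"]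
    show ?case
      unfolding prod.lessThan_Suc sum.lessThan_Suc
      using Suc m by (simp add: psum_linear del: mult_pCons_left mult_pCons_right)
  qed (simp add: psum_1)
  thus "psum1 (orbit_poly a k) = tr k a" "psum2 (orbit_poly a k) = tr k (a ^ 2)"
    by (simp_all add: orbit_poly_def tr_def power_mult[symmetric] mult.commute)
qed

lemma order_orbit_poly: "order b (orbit_poly a k) = card {i. i < k \<and> a ^ q ^ i = b}"
proof (induction k)
  case (Suc k)
  have lin: "order b [:- x, 1:] = (if x = b then 1 else 0)" for x :: 'k
    using order_power_n_n[of b 1] by (auto intro: order_0I)
  have "order b (orbit_poly a (Suc k)) = order b (orbit_poly a k) + order b [:- (a ^ q ^ k), 1:]"
    using order_mult[of "orbit_poly a k" "[:- (a ^ q ^ k), 1:]" b] orbit_poly_nonzero[of a k]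
    by (simp add: orbit_poly_def del: mult_pCons_left mult_pCons_right)
  also have "\<dots> = card {i. i < k \<and> a ^ q ^ i = b} + (if a ^ q ^ k = b then 1 else 0)"
    by (simp only: Suc lin)
  also have "\<dots> = card {i. i < Suc k \<and> a ^ q ^ i = b}"
  proof -
    have "{i. i < Suc k \<and> a ^ q ^ i = b} =
      (if a ^ q ^ k = b then insert k {i. i < k \<and> a ^ q ^ i = b} else {i. i < k \<and> a ^ q ^ i = b})"
      by (auto simp: less_Suc_eq)
    thus ?thesis by simp
  qed
  finally show ?case .
qed (simp add: orbit_poly_def)

lemma order_frob_le:
  assumes "f \<in> monic_polys n"
  shows "order a f \<le> order (a ^ q ^ i) f"
proof (induction i)
  case (Suc i)
  have nz: "f \<noteq> 0" using assms by (rule monic_polys_nonzero)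
  have *: "order b f \<le> order (b ^ q) f" for b
  proof -
    obtain g where "f = [:- b, 1:] ^ order b f * g"
      using order_1[of b f] by (elim dvdE)
    hence "frob_poly f = [:- (b ^ q), 1:] ^ order b f * frob_poly g"
      by (metis frob_poly_mult frob_poly_power frob_poly_linear)
    hence "[:- (b ^ q), 1:] ^ order b f dvd f"
      using assms by (metis (mono_tags, lifting) monic_polys_def mem_Collect_eq dvd_triv_left)
    thus ?thesis using nz by (simp add: order_divides)
  qed
  have "(a ^ q ^ i) ^ q = a ^ q ^ Suc i"
    by (simp add: power_mult[symmetric] mult.commute)
  with Suc *[of "a ^ q ^ i"] show ?case by simp
qed simp

definition period :: "'k \<Rightarrow> nat" where
  "period a = (LEAST d. d > 0 \<and> a ^ q ^ d = a)"

lemma frob_eq_iff_mod_period: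
  assumes "k > 0" "a ^ q ^ k = a"
  shows "period a > 0" "a ^ q ^ i = a ^ q ^ j \<longleftrightarrow> i mod period a = j mod period a"
proof -
  define d where "d = period a"
  have "d > 0 \<and> a ^ q ^ d = a"
    unfolding d_def period_def by (rule LeastI[of _ k]) (use assms in auto)
  hence d: "d > 0" "a ^ q ^ d = a" by auto
  thus "period a > 0" by (simp add: d_def)
  have min: "\<not> (a ^ q ^ e = a)" if "0 < e" "e < d" for e
    using not_less_Least[of e "\<lambda>d. d > 0 \<and> a ^ q ^ d = a"] that by (auto simp: d_def period_def)
  have mult: "a ^ q ^ (d * m) = a" for m
    using d(2) by (induction m) (auto simp: power_add power_mult)
  have red: "a ^ q ^ i = a ^ q ^ (i mod d)" for i
  proof -
    have "a ^ q ^ i = a ^ q ^ (d * (i div d) + i mod d)" by simp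
    also have "\<dots> = (a ^ q ^ (d * (i div d))) ^ q ^ (i mod d)"
      by (simp only: frob_pow_pow)
    finally show ?thesis by (simp only: mult)
  qed
  have inj: "a ^ q ^ i \<noteq> a ^ q ^ j" if "i < j" "j < d" for i j
  proof
    assume "a ^ q ^ i = a ^ q ^ j"
    also have "\<dots> = (a ^ q ^ (j - i)) ^ q ^ i"
      using that by (simp only: frob_pow_pow) simp
    finally have "a = a ^ q ^ (j - i)" by (rule frob_inj)
    moreover have "j - i < d" using that by simp
    ultimately show False using min[of "j - i"] that by simp
  qed
  have "a ^ q ^ i = a ^ q ^ j \<longleftrightarrow> a ^ q ^ (i mod d) = a ^ q ^ (j mod d)"
    using red[of i] red[of j] by simp
  also have "\<dots> \<longleftrightarrow> i mod d = j mod d"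
    using inj[of "i mod d" "j mod d"] inj[of "j mod d" "i mod d"] d(1)
    by (metis mod_less_divisor nat_neq_iff)
  finally show "a ^ q ^ i = a ^ q ^ j \<longleftrightarrow> i mod period a = j mod period a"
    by (simp add: d_def)
qed

lemma root_periodic:
  assumes "f \<in> monic_polys n" "poly f a = 0"
  shows "\<exists>k>0. a ^ q ^ k = a"
proof -
  have nz: "f \<noteq> 0" using assms(1) by (rule monic_polys_nonzero)
  have "poly f (a ^ q ^ i) = 0" for i
    using order_frob_le[OF assms(1), of a i] nz assms(2) by (auto simp: order_root)
  hence "range (\<lambda>i. a ^ q ^ i) \<subseteq> {x. poly f x = 0}" by auto
  hence "finite (range (\<lambda>i. a ^ q ^ i))"
    using poly_roots_finite[OF nz] finite_subset by blast
  hence "\<not> inj (\<lambda>i. a ^ q ^ i)"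
    using finite_imageD infinite_UNIV_nat by blast
  then obtain i j where "i < j" "a ^ q ^ i = a ^ q ^ j"
    unfolding inj_def by (metis nat_neq_iff)
  moreover have "(a ^ q ^ (j - i)) ^ q ^ i = a ^ q ^ j"
    using \<open>i < j\<close> by (simp only: frob_pow_pow) simp
  ultimately have "a ^ q ^ (j - i) = a"
    using frob_inj by metis
  with \<open>i < j\<close> show ?thesis by (intro exI[of _ "j - i"]) auto
qed

lemma card_residue_class:
  assumes "m < (d :: nat)"
  shows "card {i. i < d * j \<and> i mod d = m} = j"
proof -
  have "{i. i < d * j \<and> i mod d = m} = (\<lambda>l. m + d * l) ` {..<j}"
  proof (intro equalityI subsetI)
    fix i assume i: "i \<in> {i. i < d * j \<and> i mod d = m}"
    hence "i = m + d * (i div d)" by auto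
    moreover have "i div d < j" using i assms by (simp add: less_mult_imp_div_less mult.commute)
    ultimately show "i \<in> (\<lambda>l. m + d * l) ` {..<j}" by blast
  next
    fix i assume "i \<in> (\<lambda>l. m + d * l) ` {..<j}"
    then obtain l where l: "l < j" "i = m + d * l" by auto
    have "m + d * l < d * Suc l" using assms by simp
    also have "d * Suc l \<le> d * j" using l by (intro mult_le_mono) auto
    finally show "i \<in> {i. i < d * j \<and> i mod d = m}" using l assms by simp
  qed
  moreover have "inj_on (\<lambda>l. m + d * l) {..<j}"
    using assms by (auto simp: inj_on_def)
  ultimately show ?thesis by (simp add: card_image)
qed

lemma card_orbit_divisors_root:
  assumes f: "f \<in> monic_polys n" and a: "poly f a = 0"
  shows "card {k \<in> {1..n}. a \<in> GF (q ^ k) \<and> orbit_poly a k dvd f} = order a f"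
proof -
  define d where "d = period a"
  have nz: "f \<noteq> 0" using f by (rule monic_polys_nonzero)
  obtain k where k: "k > 0" "a ^ q ^ k = a" using root_periodic[OF f a] by blast
  have d: "d > 0" and eq_iff: "\<And>i j. a ^ q ^ i = a ^ q ^ j \<longleftrightarrow> i mod d = j mod d"
    using frob_eq_iff_mod_period[OF k] by (auto simp: d_def)
  have in_GF: "a \<in> GF (q ^ k) \<longleftrightarrow> d dvd k" for k
    using eq_iff[of k 0] by (simp add: GF_def mod_eq_0_iff_dvd)
  have ord: "order (a ^ q ^ l) (orbit_poly a (d * j)) = j" for l j
    unfolding order_orbit_poly eq_iff using d by (intro card_residue_class) simp
  have dvd_iff: "orbit_poly a (d * j) dvd f \<longleftrightarrow> j \<le> order a f" for j
  proof
    assume "orbit_poly a (d * j) dvd f"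
    thus "j \<le> order a f"
      using dvd_imp_order_le[OF nz, of "orbit_poly a (d * j)" a] ord[of 0 j] by simp
  next
    assume le: "j \<le> order a f"
    show "orbit_poly a (d * j) dvd f"
    proof (rule dvd_if_order_le[OF orbit_poly_nonzero])
      fix x
      show "order x (orbit_poly a (d * j)) \<le> order x f"
      proof (cases "\<exists>l. x = a ^ q ^ l")
        case True
        then obtain l where "x = a ^ q ^ l" by blast
        thus ?thesis using ord[of l j] le order_frob_le[OF f, of a l] by simp
      next
        case False
        hence "order x (orbit_poly a (d * j)) = 0"
          by (auto simp: order_orbit_poly)
        thus ?thesis by simp
      qed
    qed
  qed
  have "{k \<in> {1..n}. a \<in> GF (q ^ k) \<and> orbit_poly a k dvd f} = (\<lambda>j. d * j) ` {1..order a f}"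
  proof (intro equalityI subsetI)
    fix k assume "k \<in> {k \<in> {1..n}. a \<in> GF (q ^ k) \<and> orbit_poly a k dvd f}"
    hence k: "1 \<le> k" "d dvd k" "orbit_poly a k dvd f" using in_GF by auto
    then obtain j where "k = d * j" by (elim dvdE)
    moreover from this k have "j \<noteq> 0" by (intro notI) simp
    moreover have "j \<le> order a f" using k(3) \<open>k = d * j\<close> dvd_iff[of j] by blast
    ultimately show "k \<in> (\<lambda>j. d * j) ` {1..order a f}"
      by (intro image_eqI[of _ _ j]) (simp_all add: Suc_le_eq)
  next
    fix k assume "k \<in> (\<lambda>j. d * j) ` {1..order a f}"
    then obtain j where j: "k = d * j" "1 \<le> j" "j \<le> order a f"
      unfolding image_iff Bex_def atLeastAtMost_iff by blast
    hence "orbit_poly a k dvd f" using dvd_iff by simp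
    moreover from this have "k \<le> n"
      using dvd_imp_degree_le[OF _ nz, of "orbit_poly a k"] f degree_orbit_poly[of a k]
      by (simp add: monic_polys_def)
    ultimately show "k \<in> {k \<in> {1..n}. a \<in> GF (q ^ k) \<and> orbit_poly a k dvd f}"
      using j d in_GF by (auto simp: Suc_le_eq)
  qed
  moreover have "inj_on (\<lambda>j. d * j) {1..order a f}"
    using d by (auto simp: inj_on_def)
  ultimately show ?thesis by (simp add: card_image)
qed

lemma card_orbit_divisors:
  assumes f: "f \<in> monic_polys n"
  shows "(\<Sum>k=1..n. card {a \<in> GF (q ^ k). orbit_poly a k dvd f}) = n"
proof -
  define R where "R = {a. poly f a = 0}"
  have nz: "f \<noteq> 0" using f by (rule monic_polys_nonzero)
  have finR: "finite R" unfolding R_def by (rule poly_roots_finite[OF nz])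
  have root: "a \<in> R" if "orbit_poly a k dvd f" "k \<ge> 1" for a k
  proof -
    have "[:- (a ^ q ^ 0), 1:] dvd orbit_poly a k"
      unfolding orbit_poly_def using that by (intro dvd_prodI) auto
    with that have "[:- a, 1:] dvd f" by (auto intro: dvd_trans)
    thus ?thesis by (simp add: R_def poly_eq_0_iff_dvd)
  qed
  have "(\<Sum>k=1..n. card {a \<in> GF (q ^ k). orbit_poly a k dvd f}) =
    (\<Sum>k=1..n. card {a \<in> R. a \<in> GF (q ^ k) \<and> orbit_poly a k dvd f})"
    using root by (intro sum.cong refl arg_cong[of _ _ card]) auto
  also have "\<dots> = (\<Sum>a\<in>R. card {k \<in> {1..n}. a \<in> GF (q ^ k) \<and> orbit_poly a k dvd f})"
    by (rule sum_multicount_gen) (use finR in auto)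
  also have "\<dots> = (\<Sum>a\<in>R. order a f)"
    by (intro sum.cong refl card_orbit_divisors_root[OF f]) (auto simp: R_def)
  also have "\<dots> = degree f"
    using degree_eq_sum_order[OF nz] by (simp add: R_def)
  finally show ?thesis using f by (simp add: monic_polys_def)
qed

end

section \<open>The Hasse--Davenport relation for quadratic exponential sums\<close>

locale gf_character = frobenius q s ty
  for q s and ty :: "'k :: alg_closed_field itself" +
  fixes \<psi> :: "'k \<Rightarrow> complex"
  assumes char_neq_2: "CHAR('k) \<noteq> 2"
    and char_add: "x \<in> GF q \<Longrightarrow> y \<in> GF q \<Longrightarrow> \<psi> (x + y) = \<psi> x * \<psi> y"
    and char_0: "\<psi> 0 = 1"
    and char_nontriv: "\<exists>x \<in> GF q. \<psi> x \<noteq> 1"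
begin

lemma two_neq_0: "(2 :: 'k) \<noteq> 0"
proof
  assume "(2 :: 'k) = 0"
  hence "CHAR('k) dvd 2" using of_nat_eq_0_iff_char_dvd[of 2, where 'a='k] by simp
  hence "CHAR('k) = 2" using prime_char prime_nat_iff two_is_prime_nat primes_dvd_imp_eq by blast
  with char_neq_2 show False by simp
qed

definition char_sum :: "nat \<Rightarrow> 'k \<Rightarrow> 'k \<Rightarrow> complex" where
  "char_sum n c b = (\<Sum>x\<in>GF (q ^ n). \<psi> (c * tr n (x ^ 2) + b * tr n x))"

definition poly_char :: "'k \<Rightarrow> 'k \<Rightarrow> 'k poly \<Rightarrow> complex" where
  "poly_char c b f = \<psi> (c * psum2 f + b * psum1 f)"

definition poly_char_sum :: "nat \<Rightarrow> 'k \<Rightarrow> 'k \<Rightarrow> complex" where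
  "poly_char_sum n c b = (\<Sum>f\<in>monic_polys n. poly_char c b f)"

context
  fixes c b :: 'k
  assumes c: "c \<in> GF q" "c \<noteq> 0" and b: "b \<in> GF q"
begin

lemma poly_char_mult:
  assumes "f \<in> monic_polys m" "g \<in> monic_polys n"
  shows "poly_char c b (f * g) = poly_char c b f * poly_char c b g"
proof -
  have "lead_coeff f = 1" "lead_coeff g = 1"
    using assms unfolding monic_polys_def by blast+
  from psum_mult[OF this] show ?thesis
    unfolding poly_char_def using psum_in_GF[OF assms(1)] psum_in_GF[OF assms(2)] c b
    by (subst char_add[symmetric]) (auto intro!: GF_q_closed GF_mult simp: algebra_simps)
qed

lemma poly_char_orbit_poly: "poly_char c b (orbit_poly a k) = \<psi> (c * tr k (a ^ 2) + b * tr k a)"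
  by (simp add: poly_char_def psum_orbit_poly)

lemma poly_char_sum_0: "poly_char_sum 0 c b = 1"
proof -
  have "monic_polys 0 = {1}"
    using frob_poly_1 by (auto simp: monic_polys_def elim!: degree_eq_zeroE simp flip: one_pCons)
  thus ?thesis by (simp add: poly_char_sum_def poly_char_def psum_1 char_0)
qed

lemma poly_char_sum_1: "poly_char_sum 1 c b = char_sum 1 c b"
proof -
  have "bij_betw (\<lambda>a. [:- a, 1:]) (GF (q ^ 1)) (monic_polys 1)"
  proof (rule bij_betwI[of _ _ _ "\<lambda>f. - coeff f 0"])
    show "(\<lambda>a. [:- a, 1:]) \<in> GF (q ^ 1) \<rightarrow> monic_polys 1"
      by (auto simp: monic_polys_def frob_poly_linear GF_def)
    show "(\<lambda>f. - coeff f 0) \<in> monic_polys 1 \<rightarrow> GF (q ^ 1)"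
      by (auto simp: monic_polys_def frob_poly_eq_iff intro: GF_q_closed)
    fix f assume "f \<in> monic_polys 1"
    thus "[:- (- coeff f 0), 1:] = f"
      by (intro poly_eqI) (auto simp: monic_polys_def coeff_pCons coeff_eq_0 split: nat.splits)
  qed auto
  from sum.reindex_bij_betw[OF this, of "poly_char c b"] show ?thesis
    by (simp add: poly_char_sum_def char_sum_def poly_char_def psum_linear tr_def)
qed

text \<open>Changing the coefficient of \<open>X ^ (n - 2)\<close> by a suitable constant multiplies every summand by
  the same character value, different from 1.\<close>
lemma poly_char_sum_ge_2:
  assumes n: "n \<ge> 2"
  shows "poly_char_sum n c b = 0"
proof -
  obtain x where x: "x \<in> GF q" "\<psi> x \<noteq> 1" using char_nontriv by blast
  define t where "t = - x / (2 * c)"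
  have "(2 :: 'k) \<in> GF q" using GF_q_closed(6)[of 2] by simp
  hence t: "t \<in> GF q"
    unfolding t_def using x c by (intro GF_divide GF_mult GF_q_closed) auto
  have xt: "x = - 2 * c * t" using c two_neq_0 by (simp add: t_def)
  have deg: "degree (f + monom u (n - 2)) = n" if "degree f = n" for f and u :: 'k
  proof -
    have "degree (monom u (n - 2)) < n"
      using n degree_monom_le[of u "n - 2"] by linarith
    thus ?thesis using that by (subst degree_add_eq_left) auto
  qed
  have mem: "f + monom u (n - 2) \<in> monic_polys n" if "f \<in> monic_polys n" "u \<in> GF q" for f u
    using that deg n by (auto simp: monic_polys_def frob_poly_eq_iff intro!: GF_q_closed)
  have "bij_betw (\<lambda>f. f + monom t (n - 2)) (monic_polys n) (monic_polys n)"
    by (rule bij_betwI[of _ _ _ "\<lambda>f. f + monom (- t) (n - 2)"])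
       (use mem t in \<open>auto intro: GF_q_closed simp: add.assoc add_monom\<close>)
  from sum.reindex_bij_betw[OF this, of "poly_char c b"]
  have "poly_char_sum n c b = (\<Sum>f\<in>monic_polys n. poly_char c b (f + monom t (n - 2)))"
    by (simp add: poly_char_sum_def)
  also have "\<dots> = (\<Sum>f\<in>monic_polys n. poly_char c b f * \<psi> x)"
  proof (intro sum.cong refl)
    fix f assume f: "f \<in> monic_polys n"
    hence df: "degree f = n" by (simp add: monic_polys_def)
    have r1: "coeff (reflect_poly (f + monom t (n - 2))) 1 = coeff (reflect_poly f) 1"
      using n deg[OF df, of t] df by (simp add: coeff_reflect_poly)
    have r2: "coeff (reflect_poly (f + monom t (n - 2))) 2 = coeff (reflect_poly f) 2 + t"
      using n deg[OF df, of t] df by (simp add: coeff_reflect_poly)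
    have "c * psum2 (f + monom t (n - 2)) + b * psum1 (f + monom t (n - 2)) =
      (c * psum2 f + b * psum1 f) + x"
      unfolding psum1_def psum2_def r1 r2 xt by (simp add: algebra_simps)
    thus "poly_char c b (f + monom t (n - 2)) = poly_char c b f * \<psi> x"
      unfolding poly_char_def using psum_in_GF[OF f] c b x
      by (subst char_add[symmetric]) (auto intro!: GF_q_closed GF_mult)
  qed
  also have "\<dots> = poly_char_sum n c b * \<psi> x"
    by (simp add: poly_char_sum_def sum_distrib_right)
  finally show ?thesis using x by simp
qed

text \<open>The logarithmic derivative of the Euler product of the L-function
  \<open>\<Sum>n. poly_char_sum n c b * T ^ n\<close>, read off coefficientwise.\<close>
lemma poly_char_sum_recurrence:
  "of_nat n * poly_char_sum n c b = (\<Sum>k=1..n. char_sum k c b * poly_char_sum (n - k) c b)"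
proof -
  have inner: "(\<Sum>f | f \<in> monic_polys n \<and> orbit_poly a k dvd f. poly_char c b f) =
      poly_char c b (orbit_poly a k) * poly_char_sum (n - k) c b"
    if k: "k \<in> {1..n}" and a: "a \<in> GF (q ^ k)" for a k
  proof -
    note o = orbit_poly_in_monic_polys[OF a]
    have n: "n = k + (n - k)" using k by simp
    have "(\<lambda>h. orbit_poly a k * h) ` monic_polys (n - k) =
        {f \<in> monic_polys n. orbit_poly a k dvd f}"
    proof (intro equalityI subsetI)
      fix f assume "f \<in> {f \<in> monic_polys n. orbit_poly a k dvd f}"
      then obtain h where h: "f = orbit_poly a k * h" "f \<in> monic_polys (k + (n - k))"
        using n by (auto elim: dvdE)
      hence "h \<in> monic_polys (n - k)"
        using monic_polys_mult_cancel[OF o] by blast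
      thus "f \<in> (\<lambda>h. orbit_poly a k * h) ` monic_polys (n - k)" using h by blast
    qed (use monic_polys_mult[OF o, of _ "n - k"] n in auto)
    moreover have "inj_on (\<lambda>h. orbit_poly a k * h) (monic_polys (n - k))"
      using orbit_poly_nonzero by (auto simp: inj_on_def)
    ultimately have bij: "bij_betw (\<lambda>h. orbit_poly a k * h) (monic_polys (n - k))
        {f \<in> monic_polys n. orbit_poly a k dvd f}"
      by (simp add: bij_betw_def)
    show ?thesis
      unfolding sum.reindex_bij_betw[OF bij, symmetric] poly_char_sum_def sum_distrib_left
      by (intro sum.cong refl poly_char_mult[OF o])
  qed
  have "of_nat n * poly_char_sum n c b = (\<Sum>f\<in>monic_polys n. of_nat n * poly_char c b f)"
    by (simp add: poly_char_sum_def sum_distrib_left)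
  also have "\<dots> = (\<Sum>f\<in>monic_polys n. \<Sum>k=1..n. \<Sum>a\<in>GF (q ^ k).
      if orbit_poly a k dvd f then poly_char c b f else 0)"
  proof (intro sum.cong refl)
    fix f assume f: "f \<in> monic_polys n"
    have "of_nat n * poly_char c b f =
      (\<Sum>k=1..n. of_nat (card {a \<in> GF (q ^ k). orbit_poly a k dvd f}) * poly_char c b f)"
      by (subst card_orbit_divisors[OF f, symmetric]) (simp add: sum_distrib_right)
    also have "\<dots> = (\<Sum>k=1..n. \<Sum>a\<in>GF (q ^ k). if orbit_poly a k dvd f then poly_char c b f else 0)"
    proof (intro sum.cong refl)
      fix k assume "k \<in> {1..n}"
      hence "finite (GF (q ^ k) :: 'k set)" by (intro finite_GF) auto
      thus "of_nat (card {a \<in> GF (q ^ k). orbit_poly a k dvd f}) * poly_char c b f =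
        (\<Sum>a\<in>GF (q ^ k). if orbit_poly a k dvd f then poly_char c b f else 0)"
        by (subst sum.inter_filter[symmetric]) auto
    qed
    finally show "of_nat n * poly_char c b f =
      (\<Sum>k=1..n. \<Sum>a\<in>GF (q ^ k). if orbit_poly a k dvd f then poly_char c b f else 0)" .
  qed
  also have "\<dots> = (\<Sum>k=1..n. \<Sum>f\<in>monic_polys n. \<Sum>a\<in>GF (q ^ k).
      if orbit_poly a k dvd f then poly_char c b f else 0)"
    by (rule sum.swap)
  also have "\<dots> = (\<Sum>k=1..n. \<Sum>a\<in>GF (q ^ k). \<Sum>f\<in>monic_polys n.
      if orbit_poly a k dvd f then poly_char c b f else 0)"
    by (intro sum.cong refl sum.swap)
  also have "\<dots> = (\<Sum>k=1..n. \<Sum>a\<in>GF (q ^ k).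
      poly_char c b (orbit_poly a k) * poly_char_sum (n - k) c b)"
    by (intro sum.cong refl, subst sum.inter_filter[symmetric, OF finite_monic_polys])
       (use inner in auto)
  finally show ?thesis
    by (simp add: char_sum_def sum_distrib_right poly_char_orbit_poly)
qed

theorem hasse_davenport_quadratic:
  assumes "n > 0"
  shows "char_sum n c b = - ((- char_sum 1 c b) ^ n)"
proof -
  have step: "char_sum (Suc n) c b = - char_sum n c b * char_sum 1 c b" if n: "n > 0" for n
  proof -
    have "0 = (\<Sum>k=1..Suc n. char_sum k c b * poly_char_sum (Suc n - k) c b)"
      using poly_char_sum_recurrence[of "Suc n"] poly_char_sum_ge_2[of "Suc n"] n by simp
    also have "\<dots> = (\<Sum>k\<in>{n, Suc n}. char_sum k c b * poly_char_sum (Suc n - k) c b)"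
      using n by (intro sum.mono_neutral_right) (auto intro!: poly_char_sum_ge_2)
    also have "\<dots> = char_sum n c b * char_sum 1 c b + char_sum (Suc n) c b"
      using poly_char_sum_0 poly_char_sum_1 by simp
    finally show ?thesis by (simp add: eq_neg_iff_add_eq_0 add.commute)
  qed
  show ?thesis
    using assms by (induction n rule: nat_induct_non_zero) (simp_all add: step)
qed

end

end

section \<open>The sign of the quadratic Gauss sum\<close>

fun qbinom :: "complex \<Rightarrow> nat \<Rightarrow> nat \<Rightarrow> complex" where
  "qbinom z m 0 = 1"
| "qbinom z 0 (Suc j) = 0"
| "qbinom z (Suc m) (Suc j) = qbinom z m j + z ^ Suc j * qbinom z m (Suc j)"

lemma qbinom_eq_0: "m < j \<Longrightarrow> qbinom z m j = 0"
  by (induction z m j rule: qbinom.induct) auto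

lemma qbinom_absorb: "(1 - z ^ Suc j) * qbinom z (Suc m) (Suc j) = (1 - z ^ Suc m) * qbinom z m j"
proof (induction m arbitrary: j)
  case 0
  show ?case by (cases j) auto
next
  case (Suc m)
  have *: "(z ^ j - z ^ Suc m) * qbinom z (Suc m) j = (1 - z ^ Suc m) * z ^ j * qbinom z m j"
  proof (cases j)
    case (Suc i)
    have "(z ^ j - z ^ Suc m) * qbinom z (Suc m) j =
      (1 - z ^ Suc m) * qbinom z (Suc m) j - (1 - z ^ Suc i) * qbinom z (Suc m) (Suc i)"
      by (simp only: Suc) (simp add: algebra_simps)
    also have "\<dots> = (1 - z ^ Suc m) * (qbinom z (Suc m) j - qbinom z m i)"
      unfolding Suc.IH by (simp add: algebra_simps)
    also have "qbinom z (Suc m) j - qbinom z m i = z ^ j * qbinom z m j"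
      by (simp add: Suc)
    finally show ?thesis by simp
  qed simp
  have "(1 - z ^ Suc j) * qbinom z (Suc (Suc m)) (Suc j) =
    (1 - z ^ Suc j) * qbinom z (Suc m) j + z ^ Suc j * ((1 - z ^ Suc j) * qbinom z (Suc m) (Suc j))"
    by (simp add: algebra_simps)
  also have "\<dots> = (1 - z ^ Suc j) * qbinom z (Suc m) j + z * ((1 - z ^ Suc m) * z ^ j * qbinom z m j)"
    unfolding Suc.IH by (simp add: algebra_simps)
  also have "\<dots> = (1 - z ^ Suc (Suc m)) * qbinom z (Suc m) j"
    unfolding *[symmetric] by (simp add: algebra_simps)
  finally show ?case .
qed

definition alt_qbinom_sum :: "complex \<Rightarrow> nat \<Rightarrow> complex" where
  "alt_qbinom_sum z m = (\<Sum>j\<le>m. (-1) ^ j * qbinom z m j)"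

lemma alt_qbinom_sum_rec: "alt_qbinom_sum z (Suc (Suc m)) = (1 - z ^ Suc m) * alt_qbinom_sum z m"
proof -
  have "alt_qbinom_sum z (Suc (Suc m)) = 1 + (\<Sum>j\<le>Suc m. (-1) ^ Suc j * qbinom z (Suc (Suc m)) (Suc j))"
    unfolding alt_qbinom_sum_def by (subst sum.atMost_Suc_shift) simp
  also have "(\<Sum>j\<le>Suc m. (-1) ^ Suc j * qbinom z (Suc (Suc m)) (Suc j)) =
    (\<Sum>j\<le>Suc m. (-1) ^ Suc j * z ^ Suc j * qbinom z (Suc m) (Suc j)) -
    (\<Sum>j\<le>Suc m. (-1) ^ j * qbinom z (Suc m) j)"
    by (subst sum_subtractf[symmetric], intro sum.cong refl) (simp add: algebra_simps)
  also have "(\<Sum>j\<le>Suc m. (-1) ^ Suc j * z ^ Suc j * qbinom z (Suc m) (Suc j)) =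
      (\<Sum>j\<le>m. (-1) ^ Suc j * z ^ Suc j * qbinom z (Suc m) (Suc j))"
    by (simp add: qbinom_eq_0)
  also have "(\<Sum>j\<le>Suc m. (-1) ^ j * qbinom z (Suc m) j) =
      1 + (\<Sum>j\<le>m. (-1) ^ Suc j * qbinom z (Suc m) (Suc j))"
    by (subst sum.atMost_Suc_shift) simp
  finally have "alt_qbinom_sum z (Suc (Suc m)) =
      (\<Sum>j\<le>m. (-1) ^ Suc j * z ^ Suc j * qbinom z (Suc m) (Suc j)) -
      (\<Sum>j\<le>m. (-1) ^ Suc j * qbinom z (Suc m) (Suc j))"
    by simp
  also have "\<dots> = (\<Sum>j\<le>m. (-1) ^ j * ((1 - z ^ Suc j) * qbinom z (Suc m) (Suc j)))"
    by (subst sum_subtractf[symmetric], intro sum.cong refl) (simp add: algebra_simps)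
  also have "\<dots> = (1 - z ^ Suc m) * alt_qbinom_sum z m"
    unfolding qbinom_absorb alt_qbinom_sum_def sum_distrib_left
    by (intro sum.cong refl) (simp only: ac_simps)
  finally show ?thesis .
qed

lemma alt_qbinom_sum_even: "alt_qbinom_sum z (2 * n) = (\<Prod>k=1..n. 1 - z ^ (2 * k - 1))"
  by (induction n) (simp_all add: alt_qbinom_sum_rec mult.commute, simp add: alt_qbinom_sum_def)

lemma qbinom_root_of_unity:
  assumes z: "z ^ Suc (Suc m) = 1" "\<And>l. 0 < l \<Longrightarrow> l < Suc (Suc m) \<Longrightarrow> z ^ l \<noteq> 1"
    and j: "j \<le> Suc m"
  shows "qbinom z (Suc m) j * z ^ (\<Sum>i\<le>j. i) = (-1) ^ j"
  using j
proof (induction j)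
  case (Suc j)
  have nz: "1 - z ^ Suc j \<noteq> 0" using z(2)[of "Suc j"] Suc.prems by simp
  have z0: "z \<noteq> 0" using z(1) by auto
  have 1: "(1 - z ^ Suc j) * qbinom z (Suc m) (Suc j) = (1 - z ^ Suc m) * qbinom z m j"
    by (rule qbinom_absorb)
  have 2: "z ^ j * (1 - z ^ Suc m) * qbinom z m j = (z ^ j - z ^ Suc m) * qbinom z (Suc m) j"
  proof (cases j)
    case (Suc i)
    show ?thesis
      using qbinom_absorb[of z i m] unfolding Suc by (simp add: algebra_simps)
  qed simp
  have "(1 - z ^ Suc j) * (qbinom z (Suc m) (Suc j) * z ^ Suc j) =
    z * (z ^ j * ((1 - z ^ Suc j) * qbinom z (Suc m) (Suc j)))"
    by (simp only: power_Suc ac_simps)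
  also have "\<dots> = z * ((z ^ j - z ^ Suc m) * qbinom z (Suc m) j)"
    unfolding 1 2[symmetric] by (simp only: ac_simps)
  also have "\<dots> = (z ^ Suc j - z ^ Suc (Suc m)) * qbinom z (Suc m) j"
    by (simp add: algebra_simps)
  also have "\<dots> = (1 - z ^ Suc j) * (- qbinom z (Suc m) j)"
    unfolding z(1) by (simp add: algebra_simps)
  finally have "qbinom z (Suc m) (Suc j) * z ^ Suc j = - qbinom z (Suc m) j"
    using nz mult_left_cancel by blast
  moreover have "qbinom z (Suc m) (Suc j) * z ^ (\<Sum>i\<le>Suc j. i) =
      (qbinom z (Suc m) (Suc j) * z ^ Suc j) * z ^ (\<Sum>i\<le>j. i)"
    by (simp only: sum.atMost_Suc power_add ac_simps)
  ultimately show ?case using Suc by simp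
qed simp

lemma sum_periodic_shift:
  fixes F :: "nat \<Rightarrow> 'a :: cancel_comm_monoid_add"
  assumes "\<And>j. F (j + N) = F j"
  shows "(\<Sum>j<N. F (j + h)) = (\<Sum>j<N. F j)"
proof (induction h)
  case (Suc h)
  have "(\<Sum>j<N. F (Suc (j + h))) + F h = (\<Sum>j<Suc N. F (j + h))"
    by (subst sum.lessThan_Suc_shift) (simp add: add.commute)
  also have "\<dots> = (\<Sum>j<N. F (j + h)) + F h"
    using assms[of h] by (simp add: add.commute)
  finally have "(\<Sum>j<N. F (Suc (j + h))) + F h = (\<Sum>j<N. F (j + h)) + F h" .
  with Suc show ?case by simp
qed simp

lemma gauss_sum_eq_prod:
  fixes u :: complex
  assumes u: "u ^ (2 * n + 1) = 1" "\<And>l. 0 < l \<Longrightarrow> l < 2 * n + 1 \<Longrightarrow> u ^ l \<noteq> 1"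
  shows "(\<Sum>j<2*n+1. u ^ j\<^sup>2) = (\<Prod>k=1..n. u ^ (2 * k - 1) - inverse (u ^ (2 * k - 1)))"
proof (cases n)
  case (Suc m)
  define N where "N = 2 * n + 1"
  define z where "z = inverse (u ^ 2)"
  have u0: "u \<noteq> 0" using u(1) by auto
  have N: "N = Suc (Suc (2 * m + 1))" by (simp add: N_def Suc)
  have "z ^ N = inverse ((u ^ N) ^ 2)"
    by (simp only: z_def power_inverse power_mult[symmetric] mult.commute)
  hence zN: "z ^ N = 1" unfolding N_def u(1) by simp
  have zl: "z ^ l \<noteq> 1" if l: "0 < l" "l < N" for l
  proof
    assume "z ^ l = 1"
    hence "u ^ (2 * l) = 1" by (simp add: z_def power_inverse power_mult)
    show False
    proof (cases "2 * l < N")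
      case True
      thus False using u(2)[of "2 * l"] l \<open>u ^ (2 * l) = 1\<close> by (simp add: N_def)
    next
      case False
      hence "u ^ (2 * l) = u ^ N * u ^ (2 * l - N)" by (simp flip: power_add)
      hence "u ^ (2 * l - N) = 1" using u(1) \<open>u ^ (2 * l) = 1\<close> by (simp add: N_def)
      moreover have "2 * l \<noteq> N" unfolding N_def by presburger
      hence "0 < 2 * l - N" using False by linarith
      moreover have "2 * l - N < N" using l False by linarith
      ultimately show False using u(2)[of "2 * l - N"] by (simp add: N_def)
    qed
  qed
  have summand: "(-1) ^ j * qbinom z (2 * n) j = u ^ (j\<^sup>2 + j)" if "j \<le> 2 * n" for j
  proof -
    have *: "qbinom z (Suc (2 * m + 1)) j * z ^ (\<Sum>i\<le>j. i) = (-1) ^ j"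
      by (rule qbinom_root_of_unity) (use zN zl that N Suc in auto)
    have "2 * (\<Sum>i\<le>j. i) = j\<^sup>2 + j"
      by (induction j) (auto simp: power2_eq_square)
    hence "z ^ (\<Sum>i\<le>j. i) = inverse (u ^ (j\<^sup>2 + j))"
      by (simp add: z_def power_inverse power_mult[symmetric])
    with * have "qbinom z (2 * n) j = (-1) ^ j * u ^ (j\<^sup>2 + j)"
      using u0 by (simp add: Suc field_simps)
    thus ?thesis by (simp add: power_mult_distrib[symmetric] flip: mult.assoc)
  qed
  have "(\<Sum>j<N. u ^ (j\<^sup>2 + j)) = alt_qbinom_sum z (2 * n)"
    unfolding alt_qbinom_sum_def N_def using summand
    by (intro sum.cong) auto
  also have "\<dots> = (\<Prod>k=1..n. 1 - z ^ (2 * k - 1))"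
    by (rule alt_qbinom_sum_even)
  finally have 1: "(\<Sum>j<N. u ^ (j\<^sup>2 + j)) = (\<Prod>k=1..n. 1 - z ^ (2 * k - 1))" .
  have per: "u ^ (j + N * l) = u ^ j" for j l
    using u(1) by (simp add: N_def power_add power_mult del: mult_Suc)
  have sq: "(\<Sum>k=1..n. 2 * k - 1) = n\<^sup>2"
    by (induction n) (auto simp: power2_eq_square)
  have "(\<Sum>j<N. u ^ j\<^sup>2) = (\<Sum>j<N. u ^ (j + (n + 1))\<^sup>2)"
  proof (rule sum_periodic_shift[symmetric])
    fix j
    have "(j + N)\<^sup>2 = j\<^sup>2 + N * (2 * j + N)" by (simp add: power2_eq_square algebra_simps)
    thus "u ^ (j + N)\<^sup>2 = u ^ j\<^sup>2" by (simp only: per)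
  qed
  also have "\<dots> = (\<Sum>j<N. u ^ n\<^sup>2 * u ^ (j\<^sup>2 + j))"
  proof (intro sum.cong refl)
    fix j
    have "(j + (n + 1))\<^sup>2 = (n\<^sup>2 + (j\<^sup>2 + j)) + N * (j + 1)"
      by (simp add: power2_eq_square N_def algebra_simps)
    thus "u ^ (j + (n + 1))\<^sup>2 = u ^ n\<^sup>2 * u ^ (j\<^sup>2 + j)"
      by (simp only: per power_add[symmetric])
  qed
  also have "\<dots> = (\<Prod>k=1..n. u ^ (2 * k - 1)) * (\<Prod>k=1..n. 1 - z ^ (2 * k - 1))"
    unfolding sum_distrib_left[symmetric] 1 sq[symmetric] by (simp add: power_sum)
  also have "\<dots> = (\<Prod>k=1..n. u ^ (2 * k - 1) - inverse (u ^ (2 * k - 1)))"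
    unfolding prod.distrib[symmetric]
  proof (intro prod.cong refl)
    fix k :: nat
    have "u ^ l * (1 - z ^ l) = u ^ l - inverse (u ^ l)" for l
      using u0 by (simp add: z_def power_inverse power_mult_distrib power2_eq_square field_simps)
    thus "u ^ (2 * k - 1) * (1 - z ^ (2 * k - 1)) = u ^ (2 * k - 1) - inverse (u ^ (2 * k - 1))" .
  qed
  finally show ?thesis by (simp add: N_def)
qed simp

lemma gauss_sum_norm:
  fixes u :: complex
  assumes u: "u ^ N = 1" "\<And>l. 0 < l \<Longrightarrow> l < N \<Longrightarrow> u ^ l \<noteq> 1" and N: "odd N"
  shows "(cmod (\<Sum>j<N. u ^ j\<^sup>2))\<^sup>2 = real N"
proof -
  define G where "G = (\<Sum>j<N. u ^ j\<^sup>2)"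
  have N0: "N > 0" using N by (auto intro: Nat.gr0I)
  have "norm u = 1"
    using u(1) N0 power_eq_1_iff by blast
  hence cnj: "cnj u * u = 1" by (simp add: complex_norm_square[symmetric] mult.commute)
  have per: "u ^ (j + N * l) = u ^ j" for j l
    using u(1) by (simp add: power_add power_mult)
  have inner: "(\<Sum>x<N. u ^ x\<^sup>2 * cnj u ^ y\<^sup>2) = (\<Sum>t<N. u ^ t\<^sup>2 * (u ^ (2 * t)) ^ y)" for y
  proof -
    have "(\<Sum>x<N. u ^ x\<^sup>2) = (\<Sum>t<N. u ^ (t + y)\<^sup>2)"
    proof (rule sum_periodic_shift[symmetric])
      fix j
      have "(j + N)\<^sup>2 = j\<^sup>2 + N * (2 * j + N)" by (simp add: power2_eq_square algebra_simps)
      thus "u ^ (j + N)\<^sup>2 = u ^ j\<^sup>2" by (simp only: per)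
    qed
    hence "(\<Sum>x<N. u ^ x\<^sup>2 * cnj u ^ y\<^sup>2) = (\<Sum>t<N. u ^ (t + y)\<^sup>2 * cnj u ^ y\<^sup>2)"
      by (simp flip: sum_distrib_right)
    also have "\<dots> = (\<Sum>t<N. u ^ t\<^sup>2 * (u ^ (2 * t)) ^ y)"
    proof (intro sum.cong refl)
      fix t
      have "(t + y)\<^sup>2 = t\<^sup>2 + 2 * t * y + y\<^sup>2" by (simp add: power2_sum)
      hence "u ^ (t + y)\<^sup>2 * cnj u ^ y\<^sup>2 = u ^ t\<^sup>2 * (u ^ (2 * t)) ^ y * (cnj u * u) ^ y\<^sup>2"
        by (simp add: power_add power_mult_distrib power_mult[symmetric] mult.assoc)
      thus "u ^ (t + y)\<^sup>2 * cnj u ^ y\<^sup>2 = u ^ t\<^sup>2 * (u ^ (2 * t)) ^ y"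
        by (simp only: cnj power_one mult_1_right)
    qed
    finally show ?thesis .
  qed
  have geom: "(\<Sum>y<N. (u ^ (2 * t)) ^ y) = (if t = 0 then of_nat N else 0)" if "t < N" for t
  proof (cases "t = 0")
    case False
    have "u ^ (2 * t) \<noteq> 1"
    proof (cases "2 * t < N")
      case True
      thus ?thesis using u(2)[of "2 * t"] False by simp
    next
      case F: False
      hence "u ^ (2 * t) = u ^ N * u ^ (2 * t - N)" by (simp flip: power_add)
      moreover have "0 < 2 * t - N" using F N by (cases "2 * t = N") auto
      moreover have "2 * t - N < N" using that F by linarith
      ultimately show ?thesis using u(2)[of "2 * t - N"] u(1) by simp
    qed
    moreover have "(u ^ (2 * t)) ^ N = 1"
      using per[of 0 "2 * t"] by (simp add: power_mult[symmetric] mult.commute)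
    ultimately show ?thesis using False by (simp add: sum_gp_strict)
  qed simp
  have "of_real ((cmod G)\<^sup>2) = G * cnj G" by (rule complex_norm_square)
  also have "\<dots> = (\<Sum>y<N. \<Sum>x<N. u ^ x\<^sup>2 * cnj u ^ y\<^sup>2)"
    unfolding G_def by (subst sum.swap) (simp add: sum_product)
  also have "\<dots> = (\<Sum>t<N. \<Sum>y<N. u ^ t\<^sup>2 * (u ^ (2 * t)) ^ y)"
    unfolding inner by (rule sum.swap)
  also have "\<dots> = (\<Sum>t<N. u ^ t\<^sup>2 * (if t = 0 then of_nat N else 0))"
    unfolding sum_distrib_left[symmetric] by (intro sum.cong refl) (use geom in auto)
  also have "\<dots> = of_nat N"
    using N0 by (simp add: if_distrib sum.delta cong: if_cong)
  finally have "complex_of_real ((cmod G)\<^sup>2) = complex_of_real (real N)" by simp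
  thus ?thesis unfolding G_def of_real_eq_iff .
qed

theorem gauss_sum_value:
  assumes N: "odd N"
  shows "(\<Sum>j<N. cis (2 * pi / real N) ^ j\<^sup>2) = (if N mod 4 = 1 then 1 else \<i>) * sqrt (real N)"
proof -
  define n where "n = N div 2"
  define u where "u = cis (2 * pi / real N)"
  have Nn: "N = 2 * n + 1" using N by (auto simp: n_def)
  have upow: "u ^ l = cis (2 * pi * real l / real N)" for l
    unfolding u_def Complex.DeMoivre by (simp add: mult.commute mult.left_commute)
  have uN: "u ^ N = 1" using N unfolding upow by (auto simp: field_simps complex_eq_iff)
  have ul: "u ^ l \<noteq> 1" if "0 < l" "l < N" for l
  proof -
    have "u ^ l = exp (2 * of_real pi * \<i> * of_nat l / of_nat N)"
      by (simp add: upow cis_conv_exp mult.commute mult.left_commute)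
    thus ?thesis using complex_root_unity_eq_1[of N l] that by (auto dest: dvd_imp_le)
  qed
  define P where "P = (\<Prod>k=1..n. 2 * sin (2 * pi * real (2 * k - 1) / real N))"
  have "(\<Sum>j<N. u ^ j\<^sup>2) = (\<Prod>k=1..n. u ^ (2 * k - 1) - inverse (u ^ (2 * k - 1)))"
    using gauss_sum_eq_prod[of u n] uN ul unfolding Nn by simp
  also have "\<dots> = (\<Prod>k=1..n. \<i> * of_real (2 * sin (2 * pi * real (2 * k - 1) / real N)))"
    by (intro prod.cong refl) (simp add: upow complex_eq_iff)
  also have "\<dots> = \<i> ^ n * of_real P"
    by (simp add: P_def prod.distrib)
  finally have G: "(\<Sum>j<N. u ^ j\<^sup>2) = \<i> ^ n * of_real P" .
  have "(cmod (\<i> ^ n * of_real P))\<^sup>2 = real N"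
    using gauss_sum_norm[OF uN ul N] unfolding G .
  hence absP: "\<bar>P\<bar> = sqrt (real N)"
    by (simp add: norm_mult norm_power real_sqrt_unique[symmetric])
  have "sgn (\<Prod>k\<in>A. f k) = (\<Prod>k\<in>A. sgn (f k))" for A and f :: "nat \<Rightarrow> real"
    by (induction A rule: infinite_finite_induct) (simp_all add: sgn_mult)
  hence "sgn P = (\<Prod>k=1..n. sgn (sin (2 * pi * real (2 * k - 1) / real N)))"
    by (simp add: P_def sgn_mult)
  also have "\<dots> = (\<Prod>k=1..n. if k \<le> (n + 1) div 2 then 1 else - 1)"
  proof (intro prod.cong refl)
    fix k assume k: "k \<in> {1..n}"
    define x where "x = 2 * pi * real (2 * k - 1) / real N"
    define y where "y = 2 * real (2 * k - 1) / real N"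
    have N0: "real N > 0" using Nn by simp
    have xy: "x = pi * y" by (simp add: x_def y_def)
    have y0: "y > 0" using k N0 by (simp add: y_def)
    show "sgn (sin x) = (if k \<le> (n + 1) div 2 then 1 else - 1)"
    proof (cases "k \<le> (n + 1) div 2")
      case True
      hence "2 * real (2 * k - 1) < real N" using k Nn by (simp add: of_nat_diff)
      hence "y < 1" using N0 by (simp add: y_def divide_less_eq_1)
      hence "0 < x" "x < pi"
        using y0 pi_gt_zero unfolding xy by simp_all
      thus ?thesis using True sin_gt_zero by simp
    next
      case False
      hence "2 * (2 * k - 1) > N" "2 * k - 1 < N" using k Nn by auto
      hence "2 * real (2 * k - 1) > real N" "real (2 * k - 1) < real N"
        by linarith+
      hence "1 < y" "y < 2" using N0 by (simp_all only: y_def less_divide_eq_1_pos divide_less_eq) auto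
      hence "pi < x" "x < 2 * pi"
        using pi_gt_zero unfolding xy by simp_all
      hence "sin x < 0" by (rule sin_lt_zero)
      thus ?thesis using False by simp
    qed
  qed
  also have "\<dots> = (-1) ^ card {k \<in> {1..n}. \<not> k \<le> (n + 1) div 2}"
    by (subst prod.If_cases) (auto simp: Int_def)
  also have "{k \<in> {1..n}. \<not> k \<le> (n + 1) div 2} = {(n + 1) div 2 + 1..n}" by auto
  also have "card \<dots> = n - (n + 1) div 2" by simp
  also have "\<dots> = n div 2" by presburger
  finally have "sgn P = (-1) ^ (n div 2)" .
  hence P: "P = (-1) ^ (n div 2) * sqrt (real N)"
    using absP mult_sgn_abs[of P] by simp
  have "\<i> ^ n * (-1) ^ (n div 2) = (if N mod 4 = 1 then 1 else \<i>)"
  proof (cases "even n")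
    case True
    then obtain m where "n = 2 * m" by (elim evenE)
    thus ?thesis by (simp add: Nn power_mult power_mult_distrib[symmetric])
  next
    case False
    then obtain m where "n = 2 * m + 1" by (elim oddE)
    moreover have "(2 * (2 * m + 1) + 1) mod 4 = (3 :: nat)" by presburger
    ultimately show ?thesis by (simp add: Nn power_mult power_mult_distrib[symmetric])
  qed
  thus ?thesis using G unfolding u_def P by (simp add: mult.assoc[symmetric])
qed

section \<open>Counting points on the curve\<close>

context frobenius
begin

lemma tr_add: "tr n (x + y) = tr n x + tr n y"
  by (simp add: tr_def frob_add sum.distrib)

lemma tr_diff: "tr n (x - y) = tr n x - tr n y"
  by (simp add: tr_def frob_diff sum_subtractf)

lemma tr_0: "tr n 0 = 0"
  by (simp add: tr_def frob_0)

lemma tr_frob: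
  assumes "x \<in> GF (q ^ n)"
  shows "tr n (x ^ q) = tr n x"
proof -
  have "tr n (x ^ q) + x = (\<Sum>i<Suc n. x ^ q ^ i)"
    by (simp add: tr_def sum.lessThan_Suc_shift power_mult[symmetric] add.commute del: sum.lessThan_Suc)
  also have "\<dots> = tr n x + x"
    using assms by (simp add: tr_def GF_def)
  finally show ?thesis by simp
qed

lemma tr_in_GF:
  assumes "x \<in> GF (q ^ n)"
  shows "tr n x \<in> GF q"
proof -
  have "(tr n x) ^ q = tr n (x ^ q)"
    using frob_sum[of "\<lambda>i. x ^ q ^ i" "{..<n}" 1]
    by (simp add: tr_def power_mult[symmetric] mult.commute)
  with tr_frob[OF assms] show ?thesis by (simp add: GF_def)
qed

lemma card_artin_schreier_in_GF:
  assumes "v \<in> GF (q ^ n)"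
  shows "card {y \<in> GF (q ^ n). y ^ q - y = v} = (if tr n v = 0 then q else 0)"
proof -
  have "y \<in> GF (q ^ n) \<longleftrightarrow> tr n v = 0" if "y ^ q - y = v" for y
  proof -
    have "tr n v = (\<Sum>i<n. y ^ q ^ Suc i - y ^ q ^ i)"
      unfolding that[symmetric] by (simp add: tr_def frob_diff power_mult[symmetric])
    also have "\<dots> = y ^ q ^ n - y"
      by (subst sum_lessThan_telescope) simp
    finally show ?thesis by (simp add: GF_def)
  qed
  hence "{y \<in> GF (q ^ n). y ^ q - y = v} = (if tr n v = 0 then {y. y ^ q - y = v} else {})"
    by auto
  thus ?thesis using artin_schreier_roots(2)[of 1 v] by simp
qed

lemma tr_curve_rhs:
  assumes "x \<in> GF (q ^ n)"
  shows "- 2 * tr n (x ^ (q + 1) - x ^ 2) = tr n ((x ^ q - x) ^ 2)"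
proof -
  have "tr n ((x ^ 2) ^ q) = tr n (x ^ 2)"
    using assms by (intro tr_frob GF_power)
  moreover have "(x ^ q - x) ^ 2 = ((x ^ 2) ^ q + x ^ 2) - (x ^ (q + 1) + x ^ (q + 1))"
    by (simp add: power2_eq_square algebra_simps power_mult_distrib)
  moreover have "tr n (2 * y) = 2 * tr n y" for y
    using tr_add[of n y y] by simp
  ultimately show ?thesis
    by (simp add: tr_add tr_diff)
qed

definition affine_points :: "nat \<Rightarrow> ('k \<times> 'k) set" where
  "affine_points n = {(x, y). x \<in> GF (q ^ n) \<and> y \<in> GF (q ^ n) \<and> y ^ q - y = x ^ (q + 1) - x ^ 2}"

lemma card_C_points:
  assumes n: "n > 0"
  shows "card (C_points q n :: ('k \<times> 'k \<times> 'k) set set) = card (affine_points n) + 1"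
proof -
  define K where "K = (GF (q ^ n) :: 'k set)"
  have K: "0 \<in> K" "1 \<in> K" "\<And>x y. x \<in> K \<Longrightarrow> y \<in> K \<Longrightarrow> x / y \<in> K" "\<And>x y. x \<in> K \<Longrightarrow> y \<in> K \<Longrightarrow> x * y \<in> K"
    unfolding K_def by (auto intro: GF_0 GF_1 GF_divide GF_mult)
  have q: "q > 1" by (rule q_gt_1)
  have self: "(x, y, z) \<in> proj_point K (x, y, z)" for x y z
    using K by (auto simp: proj_point_def)
  have scale: "proj_point K (c * x, c * y, c * z) = proj_point K (x, y, z)"
    if c: "c \<in> K - {0}" for c x y z
  proof -
    have scaled: "(\<lambda>d. d * c) ` (K - {0}) = K - {0}"
    proof (intro equalityI subsetI)
      fix d assume "d \<in> K - {0}"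
      thus "d \<in> (\<lambda>d. d * c) ` (K - {0})"
        using c K by (intro image_eqI[of _ _ "d / c"]) auto
    qed (use c K in auto)
    have param: "proj_point K (x, y, z) = (\<lambda>d. (d * x, d * y, d * z)) ` (K - {0})" for x y z
      by (auto simp: proj_point_def)
    have "proj_point K (c * x, c * y, c * z) = (\<lambda>d. (d * x, d * y, d * z)) ` ((\<lambda>d. d * c) ` (K - {0}))"
      unfolding param image_image by (simp add: mult.assoc)
    thus ?thesis unfolding scaled by (simp only: param)
  qed
  define S where "S = {(x, y, z). x \<in> K \<and> y \<in> K \<and> z \<in> K \<and> (x, y, z) \<noteq> (0, 0, 0) \<and>
        y ^ q * z - y * z ^ q = x ^ (q + 1) - x ^ 2 * z ^ (q - 1)}"
  have C: "C_points q n = proj_point K ` S"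
    by (simp add: C_points_def S_def K_def)
  define E where "E = (\<lambda>(x, y). proj_point K (x, y, 1)) ` affine_points n"
  have "proj_point K ` S = insert (proj_point K (0, 1, 0)) E"
  proof (intro equalityI subsetI)
    fix P assume "P \<in> proj_point K ` S"
    then obtain x y z where xyz: "(x, y, z) \<in> S" "P = proj_point K (x, y, z)" by auto
    hence mem: "x \<in> K" "y \<in> K" "z \<in> K" "(x, y, z) \<noteq> (0, 0, 0)"
      and eq: "y ^ q * z - y * z ^ q = x ^ (q + 1) - x ^ 2 * z ^ (q - 1)"
      by (auto simp: S_def)
    show "P \<in> insert (proj_point K (0, 1, 0)) E"
    proof (cases "z = 0")
      case True
      hence "x = 0" using eq q by (simp add: zero_power)
      hence "y \<noteq> 0" using True mem by auto
      thus ?thesis using scale[of y 0 1 0] \<open>x = 0\<close> True mem xyz by simp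
    next
      case False
      have "(y / z) ^ q - y / z = (y ^ q * z - y * z ^ q) / z ^ (q + 1)"
        using False by (simp add: field_simps)
      also have "\<dots> = (x / z) ^ (q + 1) - (x / z) ^ 2"
      proof -
        have "z ^ (q + 1) = z ^ (q - 1) * z ^ 2"
          using q by (simp flip: power_add)
        thus ?thesis unfolding eq using False by (simp add: diff_divide_distrib power_divide)
      qed
      finally have "(x / z, y / z) \<in> affine_points n"
        using mem K by (simp add: affine_points_def K_def)
      moreover have "P = proj_point K (x / z, y / z, 1)"
        using scale[of z "x / z" "y / z" 1] mem False xyz by simp
      ultimately show ?thesis by (auto simp: E_def)
    qed
  next
    fix P assume "P \<in> insert (proj_point K (0, 1, 0)) E"
    moreover have "(0, 1, 0) \<in> S" using K q by (auto simp: S_def zero_power)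
    moreover have "(x, y, 1) \<in> S" if "(x, y) \<in> affine_points n" for x y
      using that K by (auto simp: S_def affine_points_def K_def)
    ultimately show "P \<in> proj_point K ` S" by (auto simp: E_def)
  qed
  moreover have "proj_point K (0, 1, 0) \<notin> E"
  proof
    assume "proj_point K (0, 1, 0) \<in> E"
    then obtain x y where "proj_point K (0, 1, 0) = proj_point K (x, y, 1)" by (auto simp: E_def)
    with self[of x y 1] have "(x, y, 1) \<in> proj_point K (0, 1, 0)" by simp
    thus False by (auto simp: proj_point_def)
  qed
  moreover have "inj_on (\<lambda>(x, y). proj_point K (x, y, 1)) (affine_points n)"
  proof (rule inj_onI, clarify)
    fix x y x' y' assume "proj_point K (x, y, 1) = proj_point K (x', y', 1)"
    with self[of x y 1] have "(x, y, 1) \<in> proj_point K (x', y', 1)" by simp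
    thus "x = x' \<and> y = y'" by (auto simp: proj_point_def)
  qed
  moreover have "finite (affine_points n)"
    by (rule finite_subset[of _ "K \<times> K"]) (use finite_GF[OF n] in \<open>auto simp: affine_points_def K_def\<close>)
  ultimately show ?thesis
    unfolding C by (simp add: E_def card_image)
qed

end

context gf_character
begin

lemma sum_char:
  assumes x: "x \<in> GF q"
  shows "(\<Sum>b\<in>GF q. \<psi> (b * x)) = (if x = 0 then of_nat q else 0)"
proof (cases "x = 0")
  case False
  obtain y where y: "y \<in> GF q" "\<psi> y \<noteq> 1" using char_nontriv by blast
  define u where "u = y / x"
  have u: "u \<in> GF q" unfolding u_def by (intro GF_divide x y)
  have ux: "u * x = y" using False by (simp add: u_def)
  have "bij_betw (\<lambda>b. b + u) (GF q) (GF q)"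
    by (rule bij_betwI[of _ _ _ "\<lambda>b. b - u"]) (use u in \<open>auto intro: GF_q_closed\<close>)
  from sum.reindex_bij_betw[OF this, of "\<lambda>b. \<psi> (b * x)"]
  have "(\<Sum>b\<in>GF q. \<psi> (b * x)) = (\<Sum>b\<in>GF q. \<psi> ((b + u) * x))" by simp
  also have "\<dots> = (\<Sum>b\<in>GF q. \<psi> (b * x) * \<psi> y)"
    by (intro sum.cong refl) (use x y in \<open>simp add: distrib_right ux char_add GF_mult\<close>)
  also have "\<dots> = (\<Sum>b\<in>GF q. \<psi> (b * x)) * \<psi> y" by (simp add: sum_distrib_right)
  finally show ?thesis using y False by simp
qed (simp add: char_0 card_GF_q)

lemma card_artin_schreier_char_sum:
  assumes "v \<in> GF (q ^ n)"
  shows "of_nat (card {y \<in> GF (q ^ n). y ^ q - y = v}) = (\<Sum>b\<in>GF q. \<psi> (b * tr n v))"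
  using sum_char[OF tr_in_GF[OF assms]] card_artin_schreier_in_GF[OF assms] by simp

lemma card_affine_points:
  assumes n: "n > 0"
  shows "of_nat (card (affine_points n)) =
    of_nat q ^ n - (\<Sum>c\<in>GF q - {0}. \<Sum>b\<in>GF q. (- char_sum 1 c b) ^ n)"
proof -
  define K where "K = (GF (q ^ n) :: 'k set)"
  have finK: "finite K" and cardK: "card K = q ^ n"
    unfolding K_def using n by (simp_all add: finite_GF card_GF)
  have frobK: "x ^ q \<in> K" if "x \<in> K" for x using that unfolding K_def by (rule GF_power)
  have diffK: "x - y \<in> K" if "x \<in> K" "y \<in> K" for x y using that unfolding K_def by (rule GF_diff)
  have powK: "x ^ j \<in> K" if "x \<in> K" for x j using that unfolding K_def by (rule GF_power)
  have two: "(2 :: 'k) \<in> GF q" using GF_q_closed(6)[of 2] by simp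
  have "affine_points n = (SIGMA x:K. {y \<in> K. y ^ q - y = x ^ (q + 1) - x ^ 2})"
    by (auto simp: affine_points_def K_def)
  hence "of_nat (card (affine_points n)) =
    (\<Sum>x\<in>K. of_nat (card {y \<in> K. y ^ q - y = x ^ (q + 1) - x ^ 2}))"
    using finK by simp
  also have "\<dots> = (\<Sum>x\<in>K. \<Sum>a\<in>GF q. \<psi> (a * tr n (x ^ (q + 1) - x ^ 2)))"
    unfolding K_def
    by (intro sum.cong refl card_artin_schreier_char_sum) (fold K_def, intro diffK powK)
  also have "\<dots> = (\<Sum>x\<in>K. \<Sum>c\<in>GF q. \<psi> (c * tr n ((x ^ q - x) ^ 2)))"
  proof (rule sum.cong[OF refl])
    fix x assume x: "x \<in> K"
    have bij: "bij_betw (\<lambda>c. - 2 * c) (GF q :: 'k set) (GF q)"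
      by (rule bij_betwI[of _ _ _ "\<lambda>c. - c / 2"])
         (use two two_neq_0 in \<open>auto intro!: GF_q_closed GF_mult GF_divide\<close>)
    have rhs: "- 2 * tr n (x ^ (q + 1) - x ^ 2) = tr n ((x ^ q - x) ^ 2)"
      using x unfolding K_def by (rule tr_curve_rhs)
    have "(\<Sum>a\<in>GF q. \<psi> (a * tr n (x ^ (q + 1) - x ^ 2))) =
        (\<Sum>c\<in>GF q. \<psi> (c * (- 2 * tr n (x ^ (q + 1) - x ^ 2))))"
      by (subst sum.reindex_bij_betw[OF bij, symmetric]) (simp add: mult_ac)
    thus "(\<Sum>a\<in>GF q. \<psi> (a * tr n (x ^ (q + 1) - x ^ 2))) =
        (\<Sum>c\<in>GF q. \<psi> (c * tr n ((x ^ q - x) ^ 2)))"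
      unfolding rhs .
  qed
  also have "\<dots> = (\<Sum>c\<in>GF q. \<Sum>x\<in>K. \<psi> (c * tr n ((x ^ q - x) ^ 2)))"
    by (rule sum.swap)
  also have "\<dots> = (\<Sum>x\<in>K. \<psi> (0 * tr n ((x ^ q - x) ^ 2))) +
      (\<Sum>c\<in>GF q - {0}. \<Sum>x\<in>K. \<psi> (c * tr n ((x ^ q - x) ^ 2)))"
    by (rule sum.remove[OF finite_GF_q GF_q_closed(5)])
  also have "(\<Sum>x\<in>K. \<psi> (0 * tr n ((x ^ q - x) ^ 2))) = of_nat q ^ n"
    by (simp add: char_0 cardK)
  also have "(\<Sum>c\<in>GF q - {0}. \<Sum>x\<in>K. \<psi> (c * tr n ((x ^ q - x) ^ 2))) =
      (\<Sum>c\<in>GF q - {0}. \<Sum>b\<in>GF q. - ((- char_sum 1 c b) ^ n))"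
  proof (rule sum.cong[OF refl])
    fix c :: 'k assume c: "c \<in> GF q - {0}"
    have "(\<Sum>x\<in>K. \<psi> (c * tr n ((x ^ q - x) ^ 2))) =
        (\<Sum>u\<in>K. \<Sum>x\<in>{x \<in> K. x ^ q - x = u}. \<psi> (c * tr n ((x ^ q - x) ^ 2)))"
      by (rule sum.group[symmetric, OF finK finK]) (use diffK frobK in auto)
    also have "\<dots> = (\<Sum>u\<in>K. of_nat (card {x \<in> K. x ^ q - x = u}) * \<psi> (c * tr n (u ^ 2)))"
      by (intro sum.cong refl) simp
    also have "\<dots> = (\<Sum>u\<in>K. \<Sum>b\<in>GF q. \<psi> (c * tr n (u ^ 2) + b * tr n u))"
    proof (intro sum.cong refl)
      fix u assume u: "u \<in> K"
      have mem: "tr n u \<in> GF q" "tr n (u ^ 2) \<in> GF q"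
        using u powK[OF u] unfolding K_def by (auto intro: tr_in_GF)
      have "of_nat (card {x \<in> K. x ^ q - x = u}) = (\<Sum>b\<in>GF q. \<psi> (b * tr n u))"
        using u unfolding K_def by (rule card_artin_schreier_char_sum)
      thus "of_nat (card {x \<in> K. x ^ q - x = u}) * \<psi> (c * tr n (u ^ 2)) =
          (\<Sum>b\<in>GF q. \<psi> (c * tr n (u ^ 2) + b * tr n u))"
        using mem c by (simp add: sum_distrib_right char_add GF_mult mult.commute)
    qed
    also have "\<dots> = (\<Sum>b\<in>GF q. char_sum n c b)"
      unfolding char_sum_def K_def[symmetric] by (rule sum.swap)
    also have "\<dots> = (\<Sum>b\<in>GF q. - ((- char_sum 1 c b) ^ n))"
      using c n by (intro sum.cong refl hasse_davenport_quadratic) auto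
    finally show "(\<Sum>x\<in>K. \<psi> (c * tr n ((x ^ q - x) ^ 2))) = (\<Sum>b\<in>GF q. - ((- char_sum 1 c b) ^ n))" .
  qed
  finally show ?thesis by (simp add: sum_negf)
qed

definition quad_char :: "'k \<Rightarrow> complex" where
  "quad_char x = (if x = 0 then 0 else if x ^ ((q - 1) div 2) = 1 then 1 else - 1)"

definition gauss_sum :: "'k \<Rightarrow> complex" where
  "gauss_sum c = (\<Sum>t\<in>GF q. \<psi> (c * t ^ 2))"

lemma odd_q: "odd q"
proof -
  have "odd CHAR('k)" using prime_char char_neq_2 prime_odd_nat[of "CHAR('k)"] prime_gt_1_nat[of "CHAR('k)"] by auto
  thus ?thesis by (simp add: q_eq)
qed

lemma GF_power_q_minus_1: "x \<in> GF q \<Longrightarrow> x \<noteq> 0 \<Longrightarrow> (x :: 'k) ^ (q - 1) = 1"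
  using q_gt_1 power_Suc[of x "q - 1"] by (simp add: GF_def)

lemma GF_power_half:
  assumes "x \<in> GF q" "(x :: 'k) \<noteq> 0"
  shows "x ^ ((q - 1) div 2) = 1 \<or> x ^ ((q - 1) div 2) = - 1"
proof -
  have "(x ^ ((q - 1) div 2))\<^sup>2 = x ^ ((q - 1) div 2 * 2)" by (rule power_mult[symmetric])
  also have "(q - 1) div 2 * 2 = q - 1" using odd_q by simp
  finally show ?thesis using GF_power_q_minus_1[OF assms] by (simp add: power2_eq_1_iff)
qed

lemma minus_1_neq_1: "(- 1 :: 'k) \<noteq> 1"
proof
  assume "(- 1 :: 'k) = 1"
  hence "(1 :: 'k) + 1 = 0" by (simp add: eq_neg_iff_add_eq_0[symmetric])
  with two_neq_0 show False by simp
qed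

lemma quad_char_mult:
  assumes "x \<in> GF q" "y \<in> GF q"
  shows "quad_char (x * y) = quad_char x * quad_char y"
proof (cases "x = 0 \<or> y = 0")
  case False
  hence "x \<noteq> 0" "y \<noteq> 0" by auto
  with GF_power_half[OF assms(1)] GF_power_half[OF assms(2)] minus_1_neq_1 show ?thesis
    by (auto simp: quad_char_def power_mult_distrib)
qed (auto simp: quad_char_def)

lemma quad_char_cases: "c \<noteq> 0 \<Longrightarrow> quad_char c = 1 \<or> quad_char c = - 1"
  by (simp add: quad_char_def)

lemma quad_char_square: "c \<noteq> 0 \<Longrightarrow> quad_char c * quad_char c = 1"
  by (simp add: quad_char_def)

lemma card_sqrt_GF:
  assumes x: "x \<in> GF q"
  shows "of_nat (card {t \<in> GF q. t ^ 2 = x}) = 1 + quad_char x"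
proof (cases "x = 0")
  case True
  have "{t \<in> GF q. t ^ 2 = x} = {0}" using True GF_q_closed(5) by auto
  thus ?thesis using True by (simp add: quad_char_def)
next
  case False
  have half: "(t ^ 2) ^ ((q - 1) div 2) = t ^ (q - 1)" for t :: 'k
    unfolding power_mult[symmetric] using odd_q by simp
  have q: "q = Suc (q - 1)" using q_gt_1 by simp
  show ?thesis
  proof (cases "x ^ ((q - 1) div 2) = 1")
    case True
    obtain d where d: "d ^ 2 = x" using nth_root_exists[of 2 x] by auto
    have "d ^ (q - 1) = 1" using half[of d] d True by simp
    hence dGF: "d \<in> GF q" using q power_Suc[of d "q - 1"] by (simp add: GF_def)
    have "d \<noteq> - d"
    proof
      assume "d = - d"
      hence "2 * d = 0" by (simp add: eq_neg_iff_add_eq_0)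
      thus False using two_neq_0 d False by simp
    qed
    moreover have "{t \<in> GF q. t ^ 2 = x} = {d, - d}"
      using dGF GF_q_closed(3)[OF dGF] d by (auto simp: power2_eq_iff)
    ultimately show ?thesis using True False by (simp add: quad_char_def)
  next
    case F: False
    have "t ^ 2 \<noteq> x" if "t \<in> GF q" for t
      using half[of t] GF_power_q_minus_1[OF that] F False by auto
    hence empty: "{t \<in> GF q. t ^ 2 = x} = {}" by auto
    show ?thesis unfolding empty using F False by (simp add: quad_char_def)
  qed
qed

lemma sum_over_squares:
  fixes F :: "'k \<Rightarrow> complex"
  shows "(\<Sum>t\<in>GF q. F (t ^ 2)) = (\<Sum>x\<in>GF q. (1 + quad_char x) * F x)"
proof -
  have "(\<Sum>t\<in>GF q. F (t ^ 2)) = (\<Sum>x\<in>GF q. \<Sum>t\<in>{t \<in> GF q. t ^ 2 = x}. F (t ^ 2))"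
    by (rule sum.group[symmetric, OF finite_GF_q finite_GF_q]) (auto intro: GF_power)
  also have "\<dots> = (\<Sum>x\<in>GF q. of_nat (card {t \<in> GF q. t ^ 2 = x}) * F x)"
    by (intro sum.cong refl) simp
  finally show ?thesis using card_sqrt_GF by simp
qed

lemma sum_quad_char: "(\<Sum>x\<in>GF q. quad_char x) = 0"
  using sum_over_squares[of "\<lambda>_. 1"] by (simp add: sum.distrib)

lemma card_quad_char:
  shows "real (card {c \<in> GF q - {0}. quad_char c = 1}) = (real q - 1) / 2"
    and "real (card {c \<in> GF q - {0}. quad_char c = - 1}) = (real q - 1) / 2"
proof -
  define A where "A = {c \<in> GF q - {0 :: 'k}. quad_char c = 1}"
  define B where "B = {c \<in> GF q - {0 :: 'k}. quad_char c = - 1}"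
  have fin: "finite A" "finite B" using finite_GF_q by (simp_all add: A_def B_def)
  have un: "GF q - {0} = A \<union> B" and disj: "A \<inter> B = {}"
    using quad_char_cases by (auto simp: A_def B_def)
  have "card (GF q - {0 :: 'k}) = q - 1"
    using card_GF_q finite_GF_q GF_q_closed(5) by (simp add: card_Diff_singleton)
  hence "q - 1 = card A + card B"
    unfolding un using card_Un_disjoint[OF fin disj] by simp
  hence 1: "real q - 1 = real (card A) + real (card B)"
    using q_gt_1 by linarith
  have "0 = (\<Sum>x\<in>GF q - {0}. quad_char x)"
    using sum_quad_char sum.remove[OF finite_GF_q GF_q_closed(5), of quad_char]
    by (simp add: quad_char_def)
  also have "\<dots> = (\<Sum>x\<in>A. quad_char x) + (\<Sum>x\<in>B. quad_char x)"
    unfolding un by (rule sum.union_disjoint[OF fin disj])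
  also have "\<dots> = of_nat (card A) - of_nat (card B)"
    by (simp add: A_def B_def)
  finally have "card A = card B" by simp
  with 1 show "real (card {c \<in> GF q - {0}. quad_char c = 1}) = (real q - 1) / 2"
    and "real (card {c \<in> GF q - {0}. quad_char c = - 1}) = (real q - 1) / 2"
    unfolding A_def[symmetric] B_def[symmetric] by simp_all
qed

lemma gauss_sum_eq_quad_char_sum:
  assumes d: "d \<in> GF q" "d \<noteq> 0"
  shows "gauss_sum d = (\<Sum>x\<in>GF q. quad_char x * \<psi> (x * d))"
proof -
  have "gauss_sum d = (\<Sum>x\<in>GF q. (1 + quad_char x) * \<psi> (x * d))"
    unfolding gauss_sum_def using sum_over_squares[of "\<lambda>x. \<psi> (x * d)"] by (simp add: mult.commute)
  also have "\<dots> = (\<Sum>x\<in>GF q. \<psi> (x * d)) + (\<Sum>x\<in>GF q. quad_char x * \<psi> (x * d))"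
    by (simp add: distrib_right sum.distrib)
  finally show ?thesis using sum_char[of d] d by simp
qed

lemma gauss_sum_quad_char:
  assumes c: "c \<in> GF q" "c \<noteq> 0"
  shows "gauss_sum c = quad_char c * gauss_sum 1"
proof -
  note eq = gauss_sum_eq_quad_char_sum
  have bij: "bij_betw (\<lambda>x. x * c) (GF q :: 'k set) (GF q)"
    by (rule bij_betwI[of _ _ _ "\<lambda>x. x / c"]) (use c in \<open>auto intro!: GF_mult GF_divide\<close>)
  have "gauss_sum 1 = (\<Sum>x\<in>GF q. quad_char (x * c) * \<psi> (x * c))"
    unfolding eq[OF GF_1 one_neq_zero] mult_1_right by (rule sum.reindex_bij_betw[OF bij, symmetric])
  also have "\<dots> = quad_char c * gauss_sum c"
    unfolding eq[OF c] sum_distrib_left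
    by (intro sum.cong refl) (simp add: quad_char_mult c mult_ac)
  finally have "quad_char c * gauss_sum 1 = (quad_char c * quad_char c) * gauss_sum c"
    by (simp add: mult.assoc)
  thus ?thesis by (simp add: quad_char_square c)
qed

lemma quad_char_char_sum:
  assumes d: "d \<in> GF q"
  shows "(\<Sum>x\<in>GF q. quad_char x * \<psi> (x * d)) = quad_char d * gauss_sum 1"
proof (cases "d = 0")
  case True
  thus ?thesis using sum_quad_char by (simp add: quad_char_def char_0)
next
  case False
  thus ?thesis using gauss_sum_eq_quad_char_sum[OF d] gauss_sum_quad_char[OF d] by simp
qed

lemma char_sum_complete_square:
  assumes c: "c \<in> GF q" "c \<noteq> 0" and b: "b \<in> GF q"
  shows "char_sum 1 c (2 * c * b) = quad_char c * gauss_sum 1 * \<psi> (- c * b ^ 2)"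
proof -
  have bij: "bij_betw (\<lambda>x. x + b) (GF q :: 'k set) (GF q)"
    by (rule bij_betwI[of _ _ _ "\<lambda>x. x - b"]) (use b in \<open>auto intro: GF_q_closed\<close>)
  have "char_sum 1 c (2 * c * b) = (\<Sum>x\<in>GF q. \<psi> (c * (x + b) ^ 2 + (- c * b ^ 2)))"
    unfolding char_sum_def tr_def
    by (intro sum.cong) (auto simp: power2_eq_square algebra_simps)
  also have "\<dots> = (\<Sum>x\<in>GF q. \<psi> (c * (x + b) ^ 2) * \<psi> (- c * b ^ 2))"
    using b c by (intro sum.cong refl char_add GF_mult GF_q_closed GF_power) auto
  also have "\<dots> = gauss_sum c * \<psi> (- c * b ^ 2)"
    unfolding gauss_sum_def sum_distrib_right[symmetric]
    by (subst sum.reindex_bij_betw[OF bij, symmetric, of "\<lambda>t. \<psi> (c * t ^ 2)"]) (rule refl)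
  finally show ?thesis using gauss_sum_quad_char[OF c] by simp
qed

end

section \<open>Reading off the reciprocal roots\<close>

lemma fps_ode_unique:
  fixes A B D :: "'a :: field_char_0 fps"
  assumes "fps_deriv A = A * D" "fps_deriv B = B * D" "fps_nth A 0 = fps_nth B 0"
  shows "A = B"
proof (rule fps_ext)
  fix n show "fps_nth A n = fps_nth B n"
  proof (induction n rule: less_induct)
    case (less n)
    show ?case
    proof (cases n)
      case (Suc m)
      have "of_nat n * fps_nth A n = fps_nth (A * D) m"
        using assms(1) fps_deriv_nth[of A m] by (simp add: Suc)
      also have "\<dots> = fps_nth (B * D) m"
        unfolding fps_mult_nth by (intro sum.cong refl) (simp add: less Suc)
      also have "\<dots> = of_nat n * fps_nth B n"
        using assms(2) fps_deriv_nth[of B m] by (simp add: Suc)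
      finally show ?thesis using Suc by (simp del: of_nat_Suc)
    qed (simp add: assms(3))
  qed
qed

lemma fps_exp_neg_power_sums:
  fixes e :: "'b \<Rightarrow> 'a :: field_char_0"
  assumes "finite I"
  shows "fps_exp 1 oo Abs_fps (\<lambda>n. if n = 0 then 0 else - (\<Sum>i\<in>I. e i ^ n) / of_nat n) =
    (\<Prod>i\<in>I. 1 - fps_const (e i) * fps_X)"
proof (rule fps_ode_unique)
  define F where "F = Abs_fps (\<lambda>n. if n = 0 then 0 else - (\<Sum>i\<in>I. e i ^ n) / of_nat n)"
  have "fps_nth F 0 = 0" by (simp add: F_def)
  thus "fps_deriv (fps_exp 1 oo F) = (fps_exp 1 oo F) * fps_deriv F"
    by (simp add: fps_compose_deriv)
  define D where "D = (\<lambda>i. Abs_fps (\<lambda>n. - (e i ^ Suc n)))"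
  have D: "(1 - fps_const (e i) * fps_X) * D i = - fps_const (e i)" for i
  proof (rule fps_ext)
    fix n
    have "(1 - fps_const (e i) * fps_X) * D i = D i - fps_const (e i) * (fps_X * D i)"
      by (simp add: left_diff_distrib mult.assoc)
    thus "fps_nth ((1 - fps_const (e i) * fps_X) * D i) n = fps_nth (- fps_const (e i)) n"
      by (cases n) (simp_all add: D_def)
  qed
  have "fps_deriv (\<Prod>i\<in>I. 1 - fps_const (e i) * fps_X) =
    (\<Prod>i\<in>I. 1 - fps_const (e i) * fps_X) * (\<Sum>i\<in>I. D i)"
    using assms
  proof (induction I)
    case (insert i I)
    define L where "L = 1 - fps_const (e i) * fps_X"
    define Q where "Q = (\<Prod>i\<in>I. 1 - fps_const (e i) * fps_X)"
    have "fps_deriv L = L * D i" using D[of i] by (simp add: L_def)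
    hence "fps_deriv (L * Q) = L * (Q * sum D I) + L * D i * Q"
      using insert.IH by (simp add: Q_def)
    also have "\<dots> = (L * Q) * (D i + sum D I)" by (simp add: distrib_left mult_ac)
    finally show ?case using insert.hyps by (simp add: L_def Q_def)
  qed simp
  also have "(\<Sum>i\<in>I. D i) = fps_deriv F"
    by (rule fps_ext) (simp add: D_def F_def fps_sum_nth sum_negf del: of_nat_Suc power_Suc)
  finally show "fps_deriv (\<Prod>i\<in>I. 1 - fps_const (e i) * fps_X) =
    (\<Prod>i\<in>I. 1 - fps_const (e i) * fps_X) * fps_deriv F" .
  show "fps_nth (fps_exp 1 oo F) 0 = fps_nth (\<Prod>i\<in>I. 1 - fps_const (e i) * fps_X) 0"
    using assms by (induction I) (simp_all add: fps_compose_nth)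
qed

lemma order_prod_one_minus:
  fixes e :: "'b \<Rightarrow> 'a :: field"
  assumes "finite I" "z \<noteq> 0"
  shows "order (inverse z) (\<Prod>i\<in>I. [:1, - e i:]) = card {i \<in> I. e i = z}"
  using assms(1)
proof (induction I)
  case (insert i I)
  have nz: "[:1, - e i:] * (\<Prod>i\<in>I. [:1, - e i:]) \<noteq> 0"
    using insert by (simp add: no_zero_divisors del: mult_pCons_left)
  have lin: "order (inverse z) [:1, - e i:] = (if e i = z then 1 else 0)"
  proof (cases "e i = z")
    case True
    have eq: "[:1, - z:] = Polynomial.smult (- z) [:- inverse z, 1:]" using assms by simp
    have "order (inverse z) [:1, - z:] = order (inverse z) [:- inverse z, 1:]"
      unfolding eq by (rule order_smult) (use assms in simp)
    thus ?thesis using True order_power_n_n[of "inverse z" 1] by simp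
  next
    case False
    thus ?thesis using assms by (auto intro!: order_0I simp: field_simps)
  qed
  have "{j \<in> insert i I. e j = z} = (if e i = z then insert i {j \<in> I. e j = z} else {j \<in> I. e j = z})"
    by auto
  thus ?case
    using insert nz order_mult[OF nz, of "inverse z"] lin by (simp del: mult_pCons_left)
qed (simp add: order_0I)

lemma fps_prod_one_minus_eq_imp_card_eq:
  fixes e :: "'b \<Rightarrow> 'a :: field" and f :: "'c \<Rightarrow> 'a"
  assumes fin: "finite I" "finite J" and card: "card I = card J" and nz: "\<And>i. i \<in> I \<Longrightarrow> e i \<noteq> 0"
    and eq: "(\<Prod>i\<in>I. 1 - fps_const (e i) * fps_X) = (\<Prod>j\<in>J. 1 - fps_const (f j) * fps_X)"
  shows "card {i \<in> I. e i = z} = card {j \<in> J. f j = z}"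
proof -
  have lin: "1 - fps_const x * fps_X = fps_of_poly [:1, - x:]" for x :: 'a
    by (rule fps_ext) (simp add: coeff_pCons split: nat.splits)
  have polys: "(\<Prod>i\<in>I. [:1, - e i:]) = (\<Prod>j\<in>J. [:1, - f j:])"
    using eq unfolding lin fps_of_poly_prod[symmetric] by (simp add: fps_of_poly_eq_iff)
  show ?thesis
  proof (cases "z = 0")
    case False
    from order_prod_one_minus[OF fin(1) this, of e] order_prod_one_minus[OF fin(2) this, of f]
    show ?thesis unfolding polys by simp
  next
    case True
    have deg: "degree (\<Prod>i\<in>K. [:1, - g i:]) = card {i \<in> K. g i \<noteq> 0}"
      if "finite K" for K :: "'d set" and g :: "'d \<Rightarrow> 'a"
    proof -
      have "degree (\<Prod>i\<in>K. [:1, - g i:]) = (\<Sum>i\<in>K. if g i \<noteq> 0 then 1 else 0)"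
        by (subst degree_prod_eq_sum_degree) (auto intro!: sum.cong)
      also have "\<dots> = card {i \<in> K. g i \<noteq> 0}"
        using that by (simp add: sum.inter_filter[symmetric])
      finally show ?thesis .
    qed
    have "{i \<in> I. e i \<noteq> 0} = I" using nz by auto
    hence "card {j \<in> J. f j \<noteq> 0} = card J"
      using deg[OF fin(1), of e] deg[OF fin(2), of f] polys card by simp
    hence "{j \<in> J. f j \<noteq> 0} = J"
      using fin by (intro card_subset_eq) auto
    hence J: "{j \<in> J. f j = z} = {}" and I: "{i \<in> I. e i = z} = {}" using nz True by auto
    show ?thesis unfolding I J by simp
  qed
qed

context frobenius
begin

lemma exists_tr_neq_0:
  assumes n: "n > 0"
  shows "\<exists>x\<in>GF (q ^ n). tr n x \<noteq> 0"
proof (rule ccontr)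
  define K where "K = (GF (q ^ n) :: 'k set)"
  assume "\<not> ?thesis"
  hence "card {y \<in> K. y ^ q - y = v} = q" if "v \<in> K" for v
    using card_artin_schreier_in_GF[of v n] that by (auto simp: K_def)
  hence "card K * q = (\<Sum>v\<in>K. card {y \<in> K. y ^ q - y = v})" by simp
  also have "\<dots> = (\<Sum>v\<in>K. \<Sum>y\<in>{y \<in> K. y ^ q - y = v}. 1)" by simp
  also have "\<dots> = (\<Sum>y\<in>K. 1)"
    by (rule sum.group) (use finite_GF[OF n] in \<open>auto simp: K_def intro: GF_diff GF_power\<close>)
  finally have "card K * q = card K" by simp
  thus False using card_GF[OF n] q_gt_1 by (simp add: K_def)
qed

end

locale curve_setup =
  fixes p r q :: nat and w :: complex and ty :: "'k :: alg_closed_field itself"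
  assumes prime_p: "prime p" and odd_p: "odd p" and r_pos: "r > 0" and q_eq_p: "q = p ^ r"
    and char_p: "CHAR('k) = p" and w_pow_p: "w ^ p = 1" and w_neq_1: "w \<noteq> 1"
begin

lemma p_gt_2: "p > 2"
  using prime_p odd_p prime_gt_1_nat[of p] by (cases "p = 2") auto

lemma w_neq_0: "w \<noteq> 0"
  using w_pow_p p_gt_2 by (auto simp: zero_power)

lemma w_power_mod: "w ^ (n mod p) = w ^ n"
proof -
  have "w ^ n = w ^ (p * (n div p) + n mod p)" by simp
  also have "\<dots> = (w ^ p) ^ (n div p) * w ^ (n mod p)" by (simp only: power_add power_mult)
  finally show ?thesis by (simp add: w_pow_p)
qed

lemma w_power_eq_1_iff: "w ^ n = 1 \<longleftrightarrow> p dvd n"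
proof
  assume n: "w ^ n = 1"
  show "p dvd n"
  proof (rule ccontr)
    assume "\<not> p dvd n"
    hence "coprime n p" using prime_p prime_imp_coprime_nat coprime_commute by blast
    then obtain x where "[n * x = 1] (mod p)" using cong_solve_coprime_nat by auto
    hence "w ^ (n * x) = w ^ 1" using w_power_mod by (metis cong_def)
    hence "w = 1" using n by (simp add: power_mult)
    with w_neq_1 show False by simp
  qed
qed (auto simp: power_mult w_pow_p)

lemma w_power_eq_iff: "w ^ m = w ^ n \<longleftrightarrow> [m = n] (mod p)"
proof (cases "m \<le> n")
  case True
  have "w ^ m = w ^ n \<longleftrightarrow> w ^ (n - m) = 1"
    using True by (metis w_neq_0 le_add_diff_inverse mult_cancel_left1 power_add power_not_zero)
    thus ?thesis
      using True cong_altdef_nat[of m n p] cong_sym_eq[of m n p] by (simp add: w_power_eq_1_iff)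
next
  case False
  have "w ^ m = w ^ n \<longleftrightarrow> w ^ (m - n) = 1"
    using False by (metis w_neq_0 le_add_diff_inverse mult_cancel_left1 power_add power_not_zero linorder_linear)
  thus ?thesis using False by (simp add: w_power_eq_1_iff cong_altdef_nat)
qed

text \<open>On the prime field the choice of \<open>m\<close> does not matter because \<open>w ^ p = 1\<close>; elsewhere no
  \<open>m\<close> exists and the value is arbitrary.\<close>
definition prime_char :: "'k \<Rightarrow> complex" where
  "prime_char x = w ^ (SOME m. of_nat m = x)"

lemma prime_char_of_nat: "prime_char (of_nat m) = w ^ m"
proof -
  have "of_nat (SOME n. of_nat n = (of_nat m :: 'k)) = (of_nat m :: 'k)"
    by (rule someI[of _ m]) simp
  thus ?thesis
    by (simp add: prime_char_def w_power_eq_iff of_nat_eq_iff_cong_CHAR char_p)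
qed

sublocale F_p: frobenius p 1 ty
  by unfold_locales (simp_all add: char_p prime_p)

lemma bij_of_nat_GF_p: "bij_betw of_nat {..<p} (GF p :: 'k set)"
proof -
  have inj: "inj_on (of_nat :: nat \<Rightarrow> 'k) {..<p}"
    by (auto simp: inj_on_def of_nat_eq_iff_cong_CHAR char_p cong_less_modulus_unique_nat)
  moreover have "of_nat ` {..<p} = (GF p :: 'k set)"
    by (rule card_subset_eq[OF F_p.finite_GF_q])
       (auto simp: card_image[OF inj] F_p.card_GF_q intro: F_p.GF_q_closed)
  ultimately show ?thesis by (simp add: bij_betw_def)
qed

lemma GF_p_cases:
  fixes x :: 'k
  assumes "x \<in> GF p"
  obtains m where "x = of_nat m" "m < p"
  using assms bij_of_nat_GF_p by (auto simp: bij_betw_def)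

sublocale F_p: gf_character p 1 ty prime_char
proof unfold_locales
  show "CHAR('k) \<noteq> 2" using p_gt_2 by (simp add: char_p)
  show "prime_char (x + y) = prime_char x * prime_char y" if "x \<in> GF p" "y \<in> GF p" for x y
    using that by (elim GF_p_cases) (simp add: prime_char_of_nat power_add flip: of_nat_add)
  show "prime_char 0 = 1" using prime_char_of_nat[of 0] by simp
  show "\<exists>x\<in>GF p. prime_char x \<noteq> 1"
    using prime_char_of_nat[of 1] w_neq_1 F_p.GF_1 by (intro bexI[of _ 1]) simp_all
qed

lemma prime_char_eq_1_iff: "x \<in> GF p \<Longrightarrow> prime_char x = 1 \<longleftrightarrow> x = 0"
  by (elim GF_p_cases) (auto simp: prime_char_of_nat w_power_eq_1_iff of_nat_eq_0_iff_char_dvd char_p)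

definition char_q :: "'k \<Rightarrow> complex" where
  "char_q x = prime_char (F_p.tr r x)"

sublocale F_q: gf_character q r ty char_q
proof unfold_locales
  show "prime CHAR('k)" "q = CHAR('k) ^ r" "r > 0" "CHAR('k) \<noteq> 2"
    using prime_p q_eq_p r_pos p_gt_2 by (simp_all add: char_p)
  show "char_q (x + y) = char_q x * char_q y" if "x \<in> GF q" "y \<in> GF q" for x y
    unfolding char_q_def using that
    by (simp add: F_p.tr_add F_p.char_add F_p.tr_in_GF q_eq_p)
  show "char_q 0 = 1" by (simp add: char_q_def F_p.tr_0 F_p.char_0)
  show "\<exists>x\<in>GF q. char_q x \<noteq> 1"
    using F_p.exists_tr_neq_0[OF r_pos] prime_char_eq_1_iff F_p.tr_in_GF
    unfolding char_q_def q_eq_p by blast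
qed

end

section \<open>Multiplicities of the reciprocal roots\<close>

context curve_setup
begin

lemma chi_p_of_int: "F_p.quad_char (of_int a) = of_int (Legendre a (int p))"
proof -
  have "[Legendre a (int p) = a ^ ((p - 1) div 2)] (mod int p)"
    using euler_criterion[of p a] prime_p p_gt_2 by simp
  hence eq: "of_int (Legendre a (int p)) = (of_int a :: 'k) ^ ((p - 1) div 2)"
    using of_int_eq_iff_cong_CHAR[where 'a = 'k] by (metis char_p of_int_power)
  have "(of_int a :: 'k) = 0 \<longleftrightarrow> [a = 0] (mod int p)"
    using of_int_eq_iff_cong_CHAR[of a 0, where 'a = 'k] by (simp add: char_p)
  thus ?thesis
    using eq F_p.minus_1_neq_1
    by (auto simp: F_p.quad_char_def Legendre_def split: if_splits)
qed

lemma chi_q_eq_chi_p_power: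
  assumes x: "x \<in> GF p"
  shows "F_q.quad_char x = F_p.quad_char x ^ r"
proof (cases "x = 0")
  case False
  define s where "s = x ^ ((p - 1) div 2)"
  have s: "s = 1 \<or> s = - 1" unfolding s_def using F_p.GF_power_half[OF x False] .
  have "(q - 1) div 2 = (p - 1) div 2 * (\<Sum>i<r. p ^ i)"
  proof -
    have "int (q - 1) = int ((p - 1) * (\<Sum>i<r. p ^ i))"
      using power_diff_1_eq[of "int p" r] p_gt_2 by (simp add: q_eq_p of_nat_diff)
    hence "q - 1 = (p - 1) * (\<Sum>i<r. p ^ i)" by (simp only: of_nat_eq_iff)
    moreover have "p - 1 = 2 * ((p - 1) div 2)" using odd_p by simp
    ultimately have "q - 1 = 2 * ((p - 1) div 2 * (\<Sum>i<r. p ^ i))" by (metis mult.assoc)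
    thus ?thesis by simp
  qed
  hence "x ^ ((q - 1) div 2) = s ^ (\<Sum>i<r. p ^ i)"
    by (simp add: s_def power_mult)
  also have "\<dots> = (\<Prod>i<r. s ^ p ^ i)" by (simp add: power_sum)
  also have "\<dots> = s ^ r" using s odd_p by auto
  finally have "x ^ ((q - 1) div 2) = s ^ r" .
  hence "F_q.quad_char x = (if s ^ r = 1 then 1 else - 1)"
    using False by (simp add: F_q.quad_char_def)
  moreover have "F_p.quad_char x = (if s = 1 then 1 else - 1)"
    using False by (simp add: F_p.quad_char_def s_def)
  ultimately show ?thesis
    using s F_p.minus_1_neq_1 by (cases "even r") auto
qed (use r_pos in \<open>simp add: F_q.quad_char_def F_p.quad_char_def zero_power\<close>)

lemma gauss_p_eq: "F_p.gauss_sum 1 = (\<Sum>m<p. w ^ m\<^sup>2)"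
proof -
  have "F_p.gauss_sum 1 = (\<Sum>m<p. prime_char (1 * of_nat m ^ 2))"
    unfolding F_p.gauss_sum_def by (rule sum.reindex_bij_betw[OF bij_of_nat_GF_p, symmetric])
  also have "\<dots> = (\<Sum>m<p. w ^ m\<^sup>2)"
    by (intro sum.cong refl) (simp add: prime_char_of_nat flip: of_nat_power)
  finally show ?thesis .
qed

lemma gauss_q_eq: "F_q.gauss_sum 1 = - ((- F_p.gauss_sum 1) ^ r)"
proof -
  have "F_p.char_sum r 1 0 = - ((- F_p.char_sum 1 1 0) ^ r)"
    using r_pos by (intro F_p.hasse_davenport_quadratic F_p.GF_q_closed F_p.GF_1) auto
  moreover have "F_p.char_sum r 1 0 = F_q.gauss_sum 1"
    by (simp add: F_p.char_sum_def F_q.gauss_sum_def char_q_def flip: q_eq_p)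
  moreover have "F_p.char_sum 1 1 0 = F_p.gauss_sum 1"
    by (simp add: F_p.char_sum_def F_p.gauss_sum_def F_p.tr_def)
  ultimately show ?thesis by simp
qed

lemma char_q_of_nat_mult: "y \<in> GF q \<Longrightarrow> char_q (of_nat t * y) = char_q y ^ t"
  by (induction t)
     (simp_all add: F_q.char_0 distrib_right F_q.char_add F_q.GF_mult F_q.GF_q_closed)

lemma char_q_range:
  assumes "y \<in> GF q"
  obtains k where "char_q y = w ^ k" "k < p"
proof -
  have "F_p.tr r y \<in> GF p" using assms F_p.tr_in_GF by (simp add: q_eq_p)
  thus thesis
    using that by (elim GF_p_cases) (simp add: char_q_def prime_char_of_nat)
qed

lemma w_power_power_p: "(w ^ m) ^ p = 1"
  by (simp add: power_mult[symmetric] mult.commute[of m]) (simp add: power_mult w_pow_p)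

definition twisted_sum :: "nat \<Rightarrow> complex" where
  "twisted_sum k = (\<Sum>t<p. F_p.quad_char (of_nat t) ^ r * inverse (w ^ k) ^ t)"

lemma card_char_q_level:
  assumes c: "c \<in> GF q" "c \<noteq> 0"
  shows "of_nat p * of_nat (card {b \<in> GF q. char_q (- c * b ^ 2) = w ^ k}) =
    of_nat q + F_q.quad_char c * F_q.quad_char (- 1) * F_q.gauss_sum 1 * twisted_sum k"
proof -
  have mem: "- c * b ^ 2 \<in> GF q" if "b \<in> GF q" for b
    using c that by (intro F_q.GF_mult F_q.GF_q_closed F_q.GF_power)
  have geom: "(\<Sum>t<p. (char_q y * inverse (w ^ k)) ^ t) = (if char_q y = w ^ k then of_nat p else 0)"
    if y: "y \<in> GF q" for y
  proof -
    define u where "u = char_q y * inverse (w ^ k)"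
    obtain l where "char_q y = w ^ l" using char_q_range[OF y] by blast
    hence "u ^ p = 1"
      by (simp add: u_def power_mult_distrib power_inverse w_power_power_p)
    moreover have "u = 1 \<longleftrightarrow> char_q y = w ^ k"
      using w_neq_0 by (simp add: u_def field_simps)
    ultimately show ?thesis unfolding u_def[symmetric] by (auto simp: sum_gp_strict)
  qed
  have "of_nat p * of_nat (card {b \<in> GF q. char_q (- c * b ^ 2) = w ^ k}) =
    (\<Sum>b\<in>GF q. if char_q (- c * b ^ 2) = w ^ k then of_nat p else (0 :: complex))"
    using F_q.finite_GF_q by (simp add: sum.inter_filter[symmetric] mult.commute)
  also have "\<dots> = (\<Sum>b\<in>GF q. \<Sum>t<p. (char_q (- c * b ^ 2) * inverse (w ^ k)) ^ t)"
    by (rule sum.cong[OF refl]) (rule geom[OF mem, symmetric])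
  also have "\<dots> = (\<Sum>t<p. \<Sum>b\<in>GF q. (char_q (- c * b ^ 2) * inverse (w ^ k)) ^ t)"
    by (rule sum.swap)
  also have "\<dots> = (\<Sum>t<p. inverse (w ^ k) ^ t * F_q.gauss_sum (of_nat t * - c))"
  proof (rule sum.cong[OF refl])
    fix t
    have "(char_q (- c * b ^ 2) * inverse (w ^ k)) ^ t =
      inverse (w ^ k) ^ t * char_q (of_nat t * - c * b ^ 2)" if "b \<in> GF q" for b
      using char_q_of_nat_mult[OF mem[OF that], of t] by (simp add: power_mult_distrib mult_ac)
    thus "(\<Sum>b\<in>GF q. (char_q (- c * b ^ 2) * inverse (w ^ k)) ^ t) =
        inverse (w ^ k) ^ t * F_q.gauss_sum (of_nat t * - c)"
      unfolding F_q.gauss_sum_def sum_distrib_left by (rule sum.cong[OF refl])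
  qed
  also have "\<dots> = (\<Sum>t<p. (if t = 0 then of_nat q else 0) +
      F_q.quad_char c * F_q.quad_char (- 1) * F_q.gauss_sum 1 * (F_p.quad_char (of_nat t) ^ r * inverse (w ^ k) ^ t))"
  proof (rule sum.cong[OF refl])
    fix t assume t: "t \<in> {..<p}"
    have nt: "(of_nat t :: 'k) \<in> GF p" by (rule F_p.GF_q_closed)
    show "inverse (w ^ k) ^ t * F_q.gauss_sum (of_nat t * - c) = (if t = 0 then of_nat q else 0) +
      F_q.quad_char c * F_q.quad_char (- 1) * F_q.gauss_sum 1 * (F_p.quad_char (of_nat t) ^ r * inverse (w ^ k) ^ t)"
    proof (cases "t = 0")
      case True
      thus ?thesis
        using r_pos by (simp add: F_q.gauss_sum_def F_q.char_0 F_q.card_GF_q F_p.quad_char_def zero_power)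
    next
      case False
      hence "(of_nat t :: 'k) \<noteq> 0"
        using t by (auto simp: of_nat_eq_0_iff_char_dvd char_p dest: dvd_imp_le)
      hence "F_q.gauss_sum (of_nat t * - c) = F_q.quad_char (of_nat t * - c) * F_q.gauss_sum 1"
        using c by (intro F_q.gauss_sum_quad_char F_q.GF_mult F_q.GF_q_closed) auto
      also have "F_q.quad_char (of_nat t * - c) = F_q.quad_char (of_nat t) * F_q.quad_char (- 1 * c)"
        using c by (subst F_q.quad_char_mult) (auto intro: F_q.GF_q_closed)
      also have "F_q.quad_char (- 1 * c) = F_q.quad_char (- 1) * F_q.quad_char c"
        using c by (intro F_q.quad_char_mult F_q.GF_q_closed F_q.GF_1)
      finally show ?thesis
        using False chi_q_eq_chi_p_power[OF nt] by simp
    qed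
  qed
  also have "\<dots> = of_nat q + F_q.quad_char c * F_q.quad_char (- 1) * F_q.gauss_sum 1 * twisted_sum k"
    using p_gt_2 unfolding sum.distrib twisted_sum_def sum_distrib_left by (simp add: sum.delta)
  finally show ?thesis .
qed

definition pairs :: "('k \<times> 'k) set" where
  "pairs = (GF q - {0}) \<times> GF q"

definition frob_eig :: "'k \<times> 'k \<Rightarrow> complex" where
  "frob_eig = (\<lambda>(c, b). - (F_q.quad_char c * F_q.gauss_sum 1 * char_q (- c * b ^ 2)))"

lemma finite_pairs: "finite pairs"
  using F_q.finite_GF_q by (simp add: pairs_def)

lemma card_pairs: "card pairs = q * (q - 1)"
  using F_q.finite_GF_q F_q.card_GF_q F_q.GF_q_closed(5) by (simp add: pairs_def card_cartesian_product)

lemma card_C_points_frob_eig: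
  assumes n: "n > 0"
  shows "of_nat (card (C_points q n :: ('k \<times> 'k \<times> 'k) set set)) - of_nat q ^ n - 1 =
    - (\<Sum>i\<in>pairs. frob_eig i ^ n)"
proof -
  have "(\<Sum>b\<in>GF q. (- F_q.char_sum 1 c b) ^ n) = (\<Sum>b\<in>GF q. frob_eig (c, b) ^ n)"
    if c: "c \<in> GF q - {0}" for c
  proof -
    have two: "(2 :: 'k) \<in> GF q" using F_q.GF_q_closed(6)[of 2] by simp
    have bij: "bij_betw (\<lambda>b. 2 * c * b) (GF q :: 'k set) (GF q)"
      by (rule bij_betwI[of _ _ _ "\<lambda>b. b / (2 * c)"])
         (use two c F_q.two_neq_0 in \<open>auto intro!: F_q.GF_mult F_q.GF_divide\<close>)
    have "(\<Sum>b\<in>GF q. (- F_q.char_sum 1 c b) ^ n) = (\<Sum>b\<in>GF q. (- F_q.char_sum 1 c (2 * c * b)) ^ n)"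
      by (rule sum.reindex_bij_betw[OF bij, symmetric])
    also have "\<dots> = (\<Sum>b\<in>GF q. frob_eig (c, b) ^ n)"
      by (rule sum.cong[OF refl]) (use c F_q.char_sum_complete_square[of c] in \<open>simp add: frob_eig_def\<close>)
    finally show ?thesis .
  qed
  hence "of_nat (card (F_q.affine_points n)) = of_nat q ^ n - (\<Sum>i\<in>pairs. frob_eig i ^ n)"
    unfolding F_q.card_affine_points[OF n] pairs_def by (simp add: sum.cartesian_product)
  thus ?thesis using F_q.card_C_points[OF n] by simp
qed

lemma L_C_eq: "L_C TYPE('k) q = (\<Prod>i\<in>pairs. 1 - fps_const (frob_eig i) * fps_X)"
proof -
  have "L_C TYPE('k) q =
    fps_exp 1 oo Abs_fps (\<lambda>n. if n = 0 then 0 else - (\<Sum>i\<in>pairs. frob_eig i ^ n) / of_nat n)"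
    unfolding L_C_def using card_C_points_frob_eig
    by (intro arg_cong2[of _ _ _ _ fps_compose] arg_cong[of _ _ Abs_fps] refl ext) simp
  also have "\<dots> = (\<Prod>i\<in>pairs. 1 - fps_const (frob_eig i) * fps_X)"
    by (rule fps_exp_neg_power_sums[OF finite_pairs])
  finally show ?thesis .
qed

lemma card_frob_eig:
  assumes s: "s = 1 \<or> s = - 1" and G: "F_q.gauss_sum 1 \<noteq> 0"
  shows "of_nat (card {i \<in> pairs. frob_eig i = - (s * F_q.gauss_sum 1 * w ^ k)}) =
    (of_nat q - 1) / 2 * ((of_nat q + s * F_q.quad_char (- 1) * F_q.gauss_sum 1 * twisted_sum k) / of_nat p)"
proof -
  define C where "C = {c \<in> GF q - {0 :: 'k}. F_q.quad_char c = s}"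
  have finC: "finite C" using F_q.finite_GF_q by (simp add: C_def)
  have "real (card C) = (real q - 1) / 2"
    using F_q.card_quad_char s by (auto simp: C_def)
  hence cardC: "complex_of_real (real (card C)) = complex_of_real ((real q - 1) / 2)" by (simp only:)
  have "{i \<in> pairs. frob_eig i = - (s * F_q.gauss_sum 1 * w ^ k)} =
      (SIGMA c:C. {b \<in> GF q. char_q (- c * b ^ 2) = w ^ k})"
  proof (intro equalityI subsetI)
    fix i assume i: "i \<in> {i \<in> pairs. frob_eig i = - (s * F_q.gauss_sum 1 * w ^ k)}"
    obtain c b where cb: "i = (c, b)" by (cases i)
    have c: "c \<in> GF q" "c \<noteq> 0" and b: "b \<in> GF q"
      and eq: "F_q.quad_char c * char_q (- c * b ^ 2) = s * w ^ k"
      using i G by (auto simp: cb pairs_def frob_eig_def)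
    have "- c * b ^ 2 \<in> GF q"
      using c b by (intro F_q.GF_mult F_q.GF_q_closed F_q.GF_power)
    then obtain l where l: "char_q (- c * b ^ 2) = w ^ l" using char_q_range by blast

    have "F_q.quad_char c ^ p = (F_q.quad_char c * char_q (- c * b ^ 2)) ^ p"
      unfolding l by (simp add: power_mult_distrib w_power_power_p)
    also have "\<dots> = s ^ p" unfolding eq by (simp add: power_mult_distrib w_power_power_p)
    finally have "F_q.quad_char c = s"
      using F_q.quad_char_cases[OF c(2)] s odd_p by auto
    thus "i \<in> (SIGMA c:C. {b \<in> GF q. char_q (- c * b ^ 2) = w ^ k})"
      using c b eq s by (auto simp: cb C_def)
  qed (auto simp: pairs_def frob_eig_def C_def)
  hence "of_nat (card {i \<in> pairs. frob_eig i = - (s * F_q.gauss_sum 1 * w ^ k)}) =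
      (\<Sum>c\<in>C. of_nat (card {b \<in> GF q. char_q (- c * b ^ 2) = w ^ k}))"
    using finC F_q.finite_GF_q by simp
  also have "\<dots> = (\<Sum>c\<in>C. (of_nat q + s * F_q.quad_char (- 1) * F_q.gauss_sum 1 * twisted_sum k) / of_nat p)"
  proof (rule sum.cong[OF refl])
    fix c assume "c \<in> C"
    hence "c \<in> GF q" "c \<noteq> 0" "F_q.quad_char c = s" by (auto simp: C_def)
    from card_char_q_level[OF this(1,2), of k] this(3)
    show "of_nat (card {b \<in> GF q. char_q (- c * b ^ 2) = w ^ k}) =
        (of_nat q + s * F_q.quad_char (- 1) * F_q.gauss_sum 1 * twisted_sum k) / of_nat p"
      using p_gt_2 by (simp add: field_simps)
  qed
  also have "\<dots> = of_nat (card C) *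
      ((of_nat q + s * F_q.quad_char (- 1) * F_q.gauss_sum 1 * twisted_sum k) / of_nat p)"
    by simp
  also have "of_nat (card C) = (of_nat q - 1) / (2 :: complex)"
    using cardC by simp
  finally show ?thesis .
qed

lemma mult_in_normalized:
  fixes \<eta> \<zeta> :: "nat \<Rightarrow> complex" and e v s :: complex
  assumes \<eta>: "L_C TYPE('k) q = (\<Prod>j = 1..q * (q - 1). 1 - fps_const (\<eta> j) * fps_X)"
    and \<zeta>: "\<forall>j\<in>{1..q * (q - 1)}. \<zeta> j = \<eta> j / complex_of_real (sqrt (real q))"
    and G: "F_q.gauss_sum 1 = e * v * sqrt (real q)" and e: "e = 1 \<or> e = - 1" and v: "v \<noteq> 0"
  shows "\<zeta> ` {1..q * (q - 1)} \<subseteq> (\<Union>k<p. {v * w ^ k, - (v * w ^ k)})"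
    and "s = 1 \<or> s = - 1 \<Longrightarrow> complex_of_real (mult_in \<zeta> (q * (q - 1)) (s * v * w ^ k)) =
      (of_nat q - s * e * F_q.quad_char (- 1) * F_q.gauss_sum 1 * twisted_sum k) / of_nat p * ((of_nat q - 1) / 2)"
proof -
  define J where "J = {1..q * (q - 1)}"
  have sq: "complex_of_real (sqrt (real q)) \<noteq> 0" using F_q.q_gt_1 by simp
  have G0: "F_q.gauss_sum 1 \<noteq> 0" using e v sq by (auto simp: G)
  have "frob_eig i \<noteq> 0" if i: "i \<in> pairs" for i
  proof -
    obtain c b where cb: "i = (c, b)" "c \<in> GF q" "c \<noteq> 0" "b \<in> GF q"
      using i by (auto simp: pairs_def)
    hence "- c * b ^ 2 \<in> GF q" by (intro F_q.GF_mult F_q.GF_q_closed F_q.GF_power)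
    then obtain l where "char_q (- c * b ^ 2) = w ^ l" using char_q_range by blast
    thus ?thesis using G0 w_neq_0 F_q.quad_char_cases[OF cb(3)] by (auto simp: cb(1) frob_eig_def)
  qed
  moreover have "(\<Prod>i\<in>pairs. 1 - fps_const (frob_eig i) * fps_X) =
      (\<Prod>j\<in>J. 1 - fps_const (\<eta> j) * fps_X)"
    using \<eta> L_C_eq unfolding J_def by simp
  ultimately have count: "card {i \<in> pairs. frob_eig i = z} = card {j \<in> J. \<eta> j = z}" for z
    by (intro fps_prod_one_minus_eq_imp_card_eq finite_pairs) (auto simp: J_def card_pairs)
  show "\<zeta> ` {1..q * (q - 1)} \<subseteq> (\<Union>k<p. {v * w ^ k, - (v * w ^ k)})"
  proof
    fix z assume "z \<in> \<zeta> ` {1..q * (q - 1)}"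
    then obtain j where j: "j \<in> J" "z = \<eta> j / complex_of_real (sqrt (real q))"
      using \<zeta> by (auto simp: J_def)
    have "card {i \<in> pairs. frob_eig i = \<eta> j} > 0"
      unfolding count using j by (subst card_gt_0_iff) (auto simp: J_def)
    then obtain i where i: "i \<in> pairs" "frob_eig i = \<eta> j"
      by (metis (mono_tags, lifting) card_gt_0_iff ex_in_conv mem_Collect_eq)
    obtain c b where "i = (c, b)" by (cases i)
    with i have cb: "\<eta> j = - (F_q.quad_char c * F_q.gauss_sum 1 * char_q (- c * b ^ 2))"
        "c \<in> GF q" "c \<noteq> 0" "b \<in> GF q"
      by (auto simp: pairs_def frob_eig_def)
    hence "- c * b ^ 2 \<in> GF q" by (intro F_q.GF_mult F_q.GF_q_closed F_q.GF_power)
    then obtain k where k: "char_q (- c * b ^ 2) = w ^ k" "k < p" using char_q_range by blast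
    have "z = - (F_q.quad_char c * e * (v * w ^ k))"
      using sq unfolding j(2) cb(1) k(1) G by simp
    hence "z = v * w ^ k \<or> z = - (v * w ^ k)"
      using e F_q.quad_char_cases[OF cb(3)] by auto
    thus "z \<in> (\<Union>k<p. {v * w ^ k, - (v * w ^ k)})" using k(2) by auto
  qed
  assume s: "s = 1 \<or> s = - 1"
  have es: "- (s * e) = 1 \<or> - (s * e) = - 1" and ee: "e * e = 1" using s e by auto
  have "\<zeta> j = s * v * w ^ k \<longleftrightarrow> \<eta> j = - (- (s * e) * F_q.gauss_sum 1 * w ^ k)" if "j \<in> J" for j
  proof -
    have "- (- (s * e) * F_q.gauss_sum 1 * w ^ k) = (e * e) * (s * v * w ^ k * sqrt (real q))"
      unfolding G by (simp add: mult_ac)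
    thus ?thesis
      using bspec[OF \<zeta>, of j] that sq unfolding J_def ee mult_1_left by (simp only: nonzero_divide_eq_eq[OF sq])
  qed
  hence "mult_in \<zeta> (q * (q - 1)) (s * v * w ^ k) =
      real (card {j \<in> J. \<eta> j = - (- (s * e) * F_q.gauss_sum 1 * w ^ k)})"
    unfolding mult_in_def J_def[symmetric] by (intro arg_cong[of _ _ real] arg_cong[of _ _ card]) auto
  thus "complex_of_real (mult_in \<zeta> (q * (q - 1)) (s * v * w ^ k)) =
      (of_nat q - s * e * F_q.quad_char (- 1) * F_q.gauss_sum 1 * twisted_sum k) / of_nat p * ((of_nat q - 1) / 2)"
    using card_frob_eig[OF es G0, of k] unfolding count by (simp add: mult_ac)
qed

lemma twisted_sum_even:
  assumes "even r"
  shows "twisted_sum 0 = of_nat p - 1" and "0 < k \<Longrightarrow> k < p \<Longrightarrow> twisted_sum k = - 1"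
proof -
  have eq: "twisted_sum k = (\<Sum>t<p. inverse (w ^ k) ^ t) - 1" for k
  proof -
    have "F_p.quad_char (of_nat t) ^ r = 1" if "t \<in> {..<p} - {0}" for t
    proof -
      have "(of_nat t :: 'k) \<noteq> 0"
        using that by (auto simp: of_nat_eq_0_iff_char_dvd char_p dest: dvd_imp_le)
      thus ?thesis using F_p.quad_char_cases[of "of_nat t"] assms by auto
    qed
    moreover have "twisted_sum k = (\<Sum>t\<in>{..<p} - {0}. F_p.quad_char (of_nat t) ^ r * inverse (w ^ k) ^ t)"
      unfolding twisted_sum_def using r_pos p_gt_2
      by (subst sum.remove[of _ 0]) (auto simp: F_p.quad_char_def zero_power)
    ultimately have "twisted_sum k = (\<Sum>t\<in>{..<p} - {0}. inverse (w ^ k) ^ t)" by simp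
    thus ?thesis using sum.remove[of "{..<p}" 0 "\<lambda>t. inverse (w ^ k) ^ t"] p_gt_2 by simp
  qed
  show "twisted_sum 0 = of_nat p - 1" by (simp add: eq)
  assume k: "0 < k" "k < p"
  hence "w ^ k \<noteq> 1" by (auto simp: w_power_eq_1_iff dest: dvd_imp_le)
  moreover have "inverse (w ^ k) ^ p = 1"
    by (simp add: power_inverse w_power_power_p)
  ultimately show "twisted_sum k = - 1"
    by (simp add: eq sum_gp_strict)
qed

lemma twisted_sum_odd:
  assumes "odd r"
  shows "twisted_sum k = F_p.quad_char (- 1) * F_p.quad_char (of_nat k) * F_p.gauss_sum 1"
proof -
  have mem: "- of_nat k \<in> (GF p :: 'k set)" by (intro F_p.GF_q_closed)
  have "twisted_sum k = (\<Sum>t<p. F_p.quad_char (of_nat t) * prime_char (of_nat t * - of_nat k))"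
    unfolding twisted_sum_def
  proof (rule sum.cong[OF refl])
    fix t
    have "F_p.quad_char (of_nat t) ^ r = F_p.quad_char (of_nat t)"
      using assms r_pos by (auto simp: F_p.quad_char_def zero_power)
    moreover have "prime_char (of_nat t * - of_nat k) = inverse (w ^ k) ^ t"
    proof -
      have "prime_char (of_nat t * - of_nat k) * prime_char (of_nat (t * k)) =
          prime_char (of_nat t * - of_nat k + of_nat (t * k))"
        by (intro F_p.char_add[symmetric] F_p.GF_mult F_p.GF_q_closed)
      also have "\<dots> = 1" by (simp add: F_p.char_0)
      finally show ?thesis
        using w_neq_0 by (simp add: prime_char_of_nat power_mult[symmetric] power_inverse mult.commute field_simps
          del: of_nat_mult)
    qed
    ultimately show "F_p.quad_char (of_nat t) ^ r * inverse (w ^ k) ^ t =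
      F_p.quad_char (of_nat t) * prime_char (of_nat t * - of_nat k)" by simp
  qed
  also have "\<dots> = (\<Sum>x\<in>GF p. F_p.quad_char x * prime_char (x * - of_nat k))"
    by (rule sum.reindex_bij_betw[OF bij_of_nat_GF_p])
  also have "\<dots> = F_p.quad_char (- 1 * of_nat k) * F_p.gauss_sum 1"
    using F_p.quad_char_char_sum[OF mem] by simp
  also have "F_p.quad_char (- 1 * of_nat k) = F_p.quad_char (- 1) * F_p.quad_char (of_nat k)"
    by (intro F_p.quad_char_mult F_p.GF_q_closed F_p.GF_1)
  finally show ?thesis .
qed

lemma chi_p_minus_1: "F_p.quad_char (- 1) = (if p mod 4 = 1 then 1 else - 1)"
proof -
  have "even ((p - 1) div 2) \<longleftrightarrow> p mod 4 = 1" using odd_p by presburger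
  thus ?thesis using F_p.minus_1_neq_1 by (cases "even ((p - 1) div 2)") (auto simp: F_p.quad_char_def)
qed

lemma gauss_p_cis:
  assumes w: "w = cis (2 * pi * real_of_int a / real p)"
  shows "F_p.gauss_sum 1 =
    of_int (Legendre a (int p)) * (if p mod 4 = 1 then 1 else \<i>) * sqrt (real p)"
proof -
  define u where "u = cis (2 * pi / real p)"
  define a' where "a' = nat (a mod int p)"
  have p0: "p > 0" using p_gt_2 by simp
  have upow: "u ^ n = cis (2 * pi * real n / real p)" for n
    unfolding u_def Complex.DeMoivre by (simp add: mult_ac)
  have up: "u ^ p = 1" using p0 by (simp add: upow complex_eq_iff)
  have "u = exp (2 * of_real pi * \<i> * of_nat 1 / of_nat p)"
    by (simp add: u_def cis_conv_exp mult_ac)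
  hence u1: "u \<noteq> 1" using complex_root_unity_eq_1[of p 1] p_gt_2 by simp
  interpret U: curve_setup p 1 p u ty
    by unfold_locales (use prime_p odd_p char_p up u1 in auto)
  have "a = int a' + int p * (a div int p)" using p0 by (simp add: a'_def)
  hence "real_of_int a = real a' + real p * real_of_int (a div int p)"
    by (metis of_int_add of_int_mult of_int_of_nat_eq)
  hence "2 * pi * real_of_int a / real p = 2 * pi * real a' / real p + 2 * pi * real_of_int (a div int p)"
    using p0 by (simp add: field_simps)
  hence wu: "w = u ^ a'"
    unfolding w upow by (simp add: cis_mult[symmetric] cis_multiple_2pi)
  have a'_mod: "(of_nat a' :: 'k) = of_int a"
    using of_int_eq_iff_cong_CHAR[of "int a'" a, where 'a = 'k] p0 by (simp add: char_p a'_def cong_def)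
  have "a' \<noteq> 0" using wu w_neq_1 by (intro notI) simp
  moreover have "a' < p" using p0 by (simp add: a'_def nat_less_iff)
  ultimately have nz: "(of_nat a' :: 'k) \<noteq> 0"
    by (auto simp: of_nat_eq_0_iff_char_dvd char_p dest: dvd_imp_le)
  have "F_p.gauss_sum 1 = (\<Sum>m<p. w ^ m\<^sup>2)" by (rule gauss_p_eq)
  also have "\<dots> = (\<Sum>m<p. U.prime_char (of_nat a' * of_nat m ^ 2))"
    unfolding wu
    by (intro sum.cong refl) (simp add: U.prime_char_of_nat power_mult flip: of_nat_power of_nat_mult)
  also have "\<dots> = U.F_p.gauss_sum (of_nat a')"
    unfolding U.F_p.gauss_sum_def
    by (rule sum.reindex_bij_betw[OF bij_of_nat_GF_p])
  also have "\<dots> = U.F_p.quad_char (of_nat a') * U.F_p.gauss_sum 1"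
    by (intro U.F_p.gauss_sum_quad_char nz F_p.GF_q_closed)
  also have "U.F_p.quad_char (of_nat a') = of_int (Legendre a (int p))"
    unfolding a'_mod by (rule U.chi_p_of_int)
  also have "U.F_p.gauss_sum 1 = (if p mod 4 = 1 then 1 else \<i>) * sqrt (real p)"
    using U.gauss_p_eq gauss_sum_value[OF odd_p] by (simp only: u_def)
  finally show ?thesis by simp
qed

lemma gauss_p_square: "(F_p.gauss_sum 1)\<^sup>2 = F_p.quad_char (- 1) * of_nat p"
proof -
  have "w \<in> {z. z ^ p = 1}" using w_pow_p by simp
  then obtain j :: nat where j: "w = exp (2 * of_real pi * \<i> * of_nat j / of_nat p)"
    using complex_roots_unity[of p] p_gt_2 by auto
  hence w: "w = cis (2 * pi * real_of_int (int j) / real p)"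
    by (simp add: cis_conv_exp mult_ac)
  have "\<not> p dvd j"
    using j w_neq_1 complex_root_unity_eq_1[of p j] p_gt_2 by auto
  hence "Legendre (int j) (int p) = 1 \<or> Legendre (int j) (int p) = - 1"
    by (simp add: Legendre_def cong_0_iff)
  hence "(of_int (Legendre (int j) (int p)) :: complex)\<^sup>2 = 1" by auto
  thus ?thesis
    unfolding gauss_p_cis[OF w] chi_p_minus_1 by (simp add: power_mult_distrib flip: of_real_power)
qed

end

theorem corollary2:
  fixes p r q :: nat and w i :: complex and \<eta> \<zeta> :: "nat \<Rightarrow> complex"
  assumes p: "prime p" "odd p"
    and q: "r \<ge> 1" "q = p ^ r"
    and char: "CHAR('k :: alg_closed_field) = p"
    and w: "primitive_root_of_unity p w"
    and i: "primitive_root_of_unity 4 i"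
    and \<eta>: "L_C TYPE('k) q = (\<Prod>j = 1..q * (q - 1). 1 - fps_const (\<eta> j) * fps_X)"
    and \<zeta>: "\<And>j. j \<in> {1..q * (q - 1)} \<Longrightarrow> \<zeta> j = \<eta> j / complex_of_real (sqrt (real q))"
  shows
    "((\<exists>s. q = s ^ 2) \<longrightarrow>
       \<zeta> ` {1..q * (q - 1)} \<subseteq> (\<Union>k<p. {w ^ k, - (w ^ k)}) \<and>
       mult_in \<zeta> (q * (q - 1)) 1
         = (real q / real p - sqrt (real q) * ((real p - 1) / real p)) * ((real q - 1) / 2) \<and>
       mult_in \<zeta> (q * (q - 1)) (- 1)
         = (real q / real p + sqrt (real q) * ((real p - 1) / real p)) * ((real q - 1) / 2) \<and>
       (\<forall>k\<in>{1..p - 1}.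
          mult_in \<zeta> (q * (q - 1)) (w ^ k)
            = (real q / real p + sqrt (real q) / real p) * ((real q - 1) / 2) \<and>
          mult_in \<zeta> (q * (q - 1)) (- (w ^ k))
            = (real q / real p - sqrt (real q) / real p) * ((real q - 1) / 2))) \<and>
     ([q = 1] (mod 4) \<and> \<not> (\<exists>s. q = s ^ 2) \<and>
     (\<exists>a :: int. w = cis (2 * pi * real_of_int a / real p) \<and> Legendre a (int p) = 1) \<longrightarrow>
       \<zeta> ` {1..q * (q - 1)} \<subseteq> (\<Union>k<p. {w ^ k, - (w ^ k)}) \<and>
       mult_in \<zeta> (q * (q - 1)) 1 = (real q / real p) * ((real q - 1) / 2) \<and>
       mult_in \<zeta> (q * (q - 1)) (- 1) = (real q / real p) * ((real q - 1) / 2) \<and>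
       (\<forall>k\<in>{1..p - 1}.
          mult_in \<zeta> (q * (q - 1)) (w ^ k)
            = (real q / real p - real_of_int (Legendre (int k) (int p)) * sqrt (real q / real p))
              * ((real q - 1) / 2) \<and>
          mult_in \<zeta> (q * (q - 1)) (- (w ^ k))
            = (real q / real p + real_of_int (Legendre (int k) (int p)) * sqrt (real q / real p))
              * ((real q - 1) / 2))) \<and>
     ([q = 3] (mod 4) \<and>
     (\<exists>a :: int. w = cis (2 * pi * real_of_int a / real p) \<and>
                 i = of_int (Legendre a (int p)) * \<i>) \<longrightarrow>
       \<zeta> ` {1..q * (q - 1)} \<subseteq> (\<Union>k<p. {i * w ^ k, - (i * w ^ k)}) \<and>
       mult_in \<zeta> (q * (q - 1)) i = (real q / real p) * ((real q - 1) / 2) \<and>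
       mult_in \<zeta> (q * (q - 1)) (- i) = (real q / real p) * ((real q - 1) / 2) \<and>
       (\<forall>k\<in>{1..p - 1}.
          mult_in \<zeta> (q * (q - 1)) (i * w ^ k)
            = (real q / real p + real_of_int (Legendre (int k) (int p)) * sqrt (real q / real p))
              * ((real q - 1) / 2) \<and>
          mult_in \<zeta> (q * (q - 1)) (- (i * w ^ k))
            = (real q / real p - real_of_int (Legendre (int k) (int p)) * sqrt (real q / real p))
              * ((real q - 1) / 2)))"
proof -
  have "p > 1" using p(1) by (rule prime_gt_1_nat)
  hence "w ^ p = 1" "w \<noteq> 1"
    using w power_one_right[of w] unfolding primitive_root_of_unity_def by auto
  then interpret curve_setup p r q w "TYPE('k)"
    using p q char by unfold_locales auto
  have \<zeta>': "\<forall>j\<in>{1..q * (q - 1)}. \<zeta> j = \<eta> j / complex_of_real (sqrt (real q))"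
    using \<zeta> by blast
  have p0: "real p > 0" using \<open>p > 1\<close> by simp
  have sqrt_pp: "sqrt (real p) * sqrt (real p) = real p" by simp
  have sqrt_q: "sqrt (real q) = sqrt (real p) * real p ^ m" if "r = 2 * m + 1" for m
    by (simp add: q(2) that real_sqrt_mult power_mult real_sqrt_power)
  have sqrt_quotient: "sqrt (real q) * sqrt (real p) / real p = sqrt (real q / real p)"
    using p0 sqrt_pp by (simp add: real_sqrt_divide field_simps)
  have legendre: "F_p.quad_char (of_nat k) = of_int (Legendre (int k) (int p))" for k
    using chi_p_of_int[of "int k"] by simp
  have chi_q_minus_1: "F_q.quad_char (- 1) = F_p.quad_char (- 1) ^ r"
    by (intro chi_q_eq_chi_p_power F_p.GF_q_closed F_p.GF_1)
  have p_mod: "p mod 4 = 1 \<or> p mod 4 = 3" using p(2) by presburger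
  have sq_mod: "[p ^ (2 * m) = 1] (mod 4)" for m
  proof -
    have "[p ^ 2 = 1] (mod 4)"
      using p_mod power_mod[of p 4 2] by (auto simp: cong_def power2_eq_square)
    from cong_pow[OF this, of m] show ?thesis by (simp add: power_mult)
  qed
  have q_mod: "[q = p] (mod 4)" if r: "odd r"
  proof -
    obtain m where m: "r = 2 * m + 1" using r by (elim oddE)
    from cong_mult[OF sq_mod[of m] cong_refl[of p 4]] show ?thesis
      by (simp add: q(2) m mult.commute)
  qed
  have legendre_0: "Legendre 0 (int p) = 0" by (simp add: Legendre_def)
  have to_real: "x = y" if "complex_of_real x = complex_of_real y" for x y
    using that by simp

  have case1: "\<zeta> ` {1..q * (q - 1)} \<subseteq> (\<Union>k<p. {1 * w ^ k, - (1 * w ^ k)}) \<and>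
    (\<forall>s \<in> {1, - 1 :: real}.
       mult_in \<zeta> (q * (q - 1)) (complex_of_real s * 1 * w ^ 0)
         = (real q / real p - s * sqrt (real q) * ((real p - 1) / real p)) * ((real q - 1) / 2) \<and>
       (\<forall>k\<in>{1..p - 1}. mult_in \<zeta> (q * (q - 1)) (complex_of_real s * 1 * w ^ k)
         = (real q / real p + s * (sqrt (real q) / real p)) * ((real q - 1) / 2)))"
    if "\<exists>s. q = s ^ 2"
  proof -
    obtain s where s: "p ^ r = s ^ 2" using \<open>\<exists>s. q = s ^ 2\<close> q(2) by auto
    have "multiplicity p (p ^ r) = r"
      using p(1) by (intro multiplicity_same_power) auto
    moreover have "s \<noteq> 0" using s p0 by (intro notI) simp
    hence "multiplicity p (s ^ 2) = 2 * multiplicity p s"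
      using p(1) by (intro prime_elem_multiplicity_power_distrib) auto
    ultimately have "r = 2 * multiplicity p s" using s by simp
    hence even: "even r" by (rule dvdI)
    then obtain m where m: "r = 2 * m" by (elim evenE)
    define e where "e = - (F_p.quad_char (- 1) ^ m)"
    have e: "e = 1 \<or> e = - 1"
      unfolding e_def chi_p_minus_1 by (cases "even m") auto
    have sqrt_q: "sqrt (real q) = real p ^ m"
      using p0 by (intro real_sqrt_unique) (simp_all add: q(2) m power_mult[symmetric] mult.commute)
    have G: "F_q.gauss_sum 1 = e * 1 * sqrt (real q)"
      unfolding gauss_q_eq sqrt_q
      by (simp add: m power_mult gauss_p_square e_def power_mult_distrib)
    have "F_q.quad_char (- 1) = 1"
      unfolding chi_q_minus_1 chi_p_minus_1 using even by simp
    hence eG: "s * e * F_q.quad_char (- 1) * F_q.gauss_sum 1 * t = s * sqrt (real q) * t" for s t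
      using e unfolding G by auto
    note M = mult_in_normalized[OF \<eta> \<zeta>' G e one_neq_zero]
    have "mult_in \<zeta> (q * (q - 1)) (complex_of_real s * 1 * w ^ 0)
         = (real q / real p - s * sqrt (real q) * ((real p - 1) / real p)) * ((real q - 1) / 2)"
      if "s = 1 \<or> s = - 1" for s :: real
    proof (rule to_real)
      have s: "complex_of_real s = 1 \<or> complex_of_real s = - 1" using that by auto
      show "complex_of_real (mult_in \<zeta> (q * (q - 1)) (complex_of_real s * 1 * w ^ 0)) = complex_of_real
        ((real q / real p - s * sqrt (real q) * ((real p - 1) / real p)) * ((real q - 1) / 2))"
        unfolding M(2)[OF s, of 0] eG twisted_sum_even(1)[OF even]
        using \<open>p > 1\<close> by (simp add: field_simps)
    qed
    moreover have "mult_in \<zeta> (q * (q - 1)) (complex_of_real s * 1 * w ^ k)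
         = (real q / real p + s * (sqrt (real q) / real p)) * ((real q - 1) / 2)"
      if "s = 1 \<or> s = - 1" "k \<in> {1..p - 1}" for s :: real and k
    proof (rule to_real)
      have s: "complex_of_real s = 1 \<or> complex_of_real s = - 1" using that by auto
      have k: "0 < k" "k < p" using that \<open>p > 1\<close> by auto
      show "complex_of_real (mult_in \<zeta> (q * (q - 1)) (complex_of_real s * 1 * w ^ k)) = complex_of_real
        ((real q / real p + s * (sqrt (real q) / real p)) * ((real q - 1) / 2))"
        unfolding M(2)[OF s, of k] eG twisted_sum_even(2)[OF even k]
        by (simp add: add_divide_distrib)
    qed
    ultimately show ?thesis using M(1) by blast
  qed

  have case23: "\<zeta> ` {1..q * (q - 1)} \<subseteq> (\<Union>k<p. {v * w ^ k, - (v * w ^ k)}) \<and>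
    (\<forall>s \<in> {1, - 1 :: real}. \<forall>k<p. mult_in \<zeta> (q * (q - 1)) (complex_of_real s * v * w ^ k)
         = (real q / real p - s * d * real_of_int (Legendre (int k) (int p)) * sqrt (real q / real p))
           * ((real q - 1) / 2))"
    if r: "odd r" and g: "F_p.gauss_sum 1 = v * sqrt (real p)" and v: "v * v = complex_of_real d"
      and d: "d = 1 \<or> d = - 1"
    for v :: complex and d :: real
  proof -
    obtain m where m: "r = 2 * m + 1" using r by (elim oddE)
    have v0: "v \<noteq> 0" using v d by auto
    have vp: "F_p.quad_char (- 1) = complex_of_real d"
    proof -
      have "(F_p.gauss_sum 1)\<^sup>2 = complex_of_real d * of_nat p"
        unfolding g power_mult_distrib by (simp add: power2_eq_square v flip: of_real_mult)
      thus ?thesis using gauss_p_square p0 by simp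
    qed
    define e where "e = complex_of_real (d ^ m)"
    have e: "e = 1 \<or> e = - 1" using d by (cases "even m") (auto simp: e_def)
    have G: "F_q.gauss_sum 1 = e * v * sqrt (real q)"
    proof -
      have "F_q.gauss_sum 1 = F_p.gauss_sum 1 * ((F_p.gauss_sum 1)\<^sup>2) ^ m"
        using r unfolding gauss_q_eq by (simp add: m power_mult)
      also have "\<dots> = e * v * (sqrt (real p) * real p ^ m)"
        unfolding gauss_p_square vp by (simp add: g e_def power_mult_distrib)
      finally show ?thesis by (simp add: sqrt_q[OF m])
    qed
    have chi: "F_q.quad_char (- 1) = complex_of_real d"
      unfolding chi_q_minus_1 vp m using d by auto
    have eG: "s * e * F_q.quad_char (- 1) * F_q.gauss_sum 1 * twisted_sum k =
        s * d * of_int (Legendre (int k) (int p)) * (sqrt (real q) * sqrt (real p))" for s :: complex and k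
    proof -
      have "s * e * F_q.quad_char (- 1) * F_q.gauss_sum 1 * twisted_sum k =
        s * (e * e) * (complex_of_real d * complex_of_real d) * (v * v) *
          of_int (Legendre (int k) (int p)) * (sqrt (real q) * sqrt (real p))"
        unfolding G chi twisted_sum_odd[OF r] vp legendre g by (simp add: mult_ac)
      also have "e * e = 1" using e by auto
      also have "complex_of_real d * complex_of_real d = 1" using d by auto
      finally show ?thesis by (simp add: v)
    qed
    note M = mult_in_normalized[OF \<eta> \<zeta>' G e v0]
    have "mult_in \<zeta> (q * (q - 1)) (complex_of_real s * v * w ^ k)
         = (real q / real p - s * d * real_of_int (Legendre (int k) (int p)) * sqrt (real q / real p))
           * ((real q - 1) / 2)"
      if "s = 1 \<or> s = - 1" for s :: real and k
    proof (rule to_real)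
      have s: "complex_of_real s = 1 \<or> complex_of_real s = - 1" using that by auto
      show "complex_of_real (mult_in \<zeta> (q * (q - 1)) (complex_of_real s * v * w ^ k)) = complex_of_real
        ((real q / real p - s * d * real_of_int (Legendre (int k) (int p)) * sqrt (real q / real p))
           * ((real q - 1) / 2))"
        unfolding M(2)[OF s, of k] eG sqrt_quotient[symmetric]
        by (simp add: diff_divide_distrib)
    qed
    thus ?thesis using M(1) by blast
  qed

  show ?thesis
  proof (rule conjI[OF _ conjI]; rule impI)
    assume "\<exists>s. q = s ^ 2"
    note c = case1[OF this]
    show "\<zeta> ` {1..q * (q - 1)} \<subseteq> (\<Union>k<p. {w ^ k, - (w ^ k)}) \<and>
       mult_in \<zeta> (q * (q - 1)) 1
         = (real q / real p - sqrt (real q) * ((real p - 1) / real p)) * ((real q - 1) / 2) \<and>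
       mult_in \<zeta> (q * (q - 1)) (- 1)
         = (real q / real p + sqrt (real q) * ((real p - 1) / real p)) * ((real q - 1) / 2) \<and>
       (\<forall>k\<in>{1..p - 1}.
          mult_in \<zeta> (q * (q - 1)) (w ^ k)
            = (real q / real p + sqrt (real q) / real p) * ((real q - 1) / 2) \<and>
          mult_in \<zeta> (q * (q - 1)) (- (w ^ k))
            = (real q / real p - sqrt (real q) / real p) * ((real q - 1) / 2))"
      using c by simp
  next
    assume *: "[q = 1] (mod 4) \<and> \<not> (\<exists>s. q = s ^ 2) \<and>
     (\<exists>a :: int. w = cis (2 * pi * real_of_int a / real p) \<and> Legendre a (int p) = 1)"
    then obtain a :: int where a: "w = cis (2 * pi * real_of_int a / real p)" "Legendre a (int p) = 1"
      by blast
    have r: "odd r"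
    proof
      assume "even r"
      then obtain m where "q = (p ^ m) ^ 2" using q(2) by (auto elim!: evenE simp: power_mult[symmetric] mult.commute)
      with * show False by blast
    qed
    have "p mod 4 = 1" using q_mod[OF r] * by (simp add: cong_def)
    hence "F_p.gauss_sum 1 = (1 :: complex) * sqrt (real p)" using gauss_p_cis[OF a(1)] a(2) by simp
    from case23[OF r this, of 1]
    have c: "\<zeta> ` {1..q * (q - 1)} \<subseteq> (\<Union>k<p. {w ^ k, - (w ^ k)})"
      and M: "\<And>s k. s = 1 \<or> s = - 1 \<Longrightarrow> k < p \<Longrightarrow>
        mult_in \<zeta> (q * (q - 1)) (complex_of_real s * w ^ k) =
        (real q / real p - s * real_of_int (Legendre (int k) (int p)) * sqrt (real q / real p)) *
          ((real q - 1) / 2)"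
      by auto
    note M1 = M[of 1] M[of "- 1"]
    show "\<zeta> ` {1..q * (q - 1)} \<subseteq> (\<Union>k<p. {w ^ k, - (w ^ k)}) \<and>
       mult_in \<zeta> (q * (q - 1)) 1 = (real q / real p) * ((real q - 1) / 2) \<and>
       mult_in \<zeta> (q * (q - 1)) (- 1) = (real q / real p) * ((real q - 1) / 2) \<and>
       (\<forall>k\<in>{1..p - 1}.
          mult_in \<zeta> (q * (q - 1)) (w ^ k)
            = (real q / real p - real_of_int (Legendre (int k) (int p)) * sqrt (real q / real p))
              * ((real q - 1) / 2) \<and>
          mult_in \<zeta> (q * (q - 1)) (- (w ^ k))
            = (real q / real p + real_of_int (Legendre (int k) (int p)) * sqrt (real q / real p))
              * ((real q - 1) / 2))"
      using c M1 M1[of 0] \<open>p > 1\<close> legendre_0 by auto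
  next
    assume *: "[q = 3] (mod 4) \<and>
     (\<exists>a :: int. w = cis (2 * pi * real_of_int a / real p) \<and>
                 i = of_int (Legendre a (int p)) * \<i>)"
    then obtain a :: int where a: "w = cis (2 * pi * real_of_int a / real p)"
        "i = of_int (Legendre a (int p)) * \<i>"
      by blast
    have r: "odd r"
    proof
      assume "even r"
      then obtain m where "r = 2 * m" by (elim evenE)
      with sq_mod[of m] * show False by (simp add: q(2) cong_def)
    qed
    have "p mod 4 = 3" using q_mod[OF r] * by (simp add: cong_def)
    hence g: "F_p.gauss_sum 1 = i * sqrt (real p)" using gauss_p_cis[OF a(1)] a(2) by simp
    have "(F_p.gauss_sum 1)\<^sup>2 = i * i * of_nat p"
      unfolding g power_mult_distrib by (simp add: power2_eq_square flip: of_real_mult)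
    hence "(i * i) * of_nat p = complex_of_real (- 1) * of_nat p"
      using gauss_p_square chi_p_minus_1 \<open>p mod 4 = 3\<close> by simp
    hence "i * i = complex_of_real (- 1)"
      using p0 by (subst (asm) mult_right_cancel) auto
    from case23[OF r g this]
    have c: "\<zeta> ` {1..q * (q - 1)} \<subseteq> (\<Union>k<p. {i * w ^ k, - (i * w ^ k)})"
      and M: "\<And>s k. s = 1 \<or> s = - 1 \<Longrightarrow> k < p \<Longrightarrow>
        mult_in \<zeta> (q * (q - 1)) (complex_of_real s * i * w ^ k) =
        (real q / real p + s * real_of_int (Legendre (int k) (int p)) * sqrt (real q / real p)) *
          ((real q - 1) / 2)"
      by auto
    note M1 = M[of 1] M[of "- 1"]
    show "\<zeta> ` {1..q * (q - 1)} \<subseteq> (\<Union>k<p. {i * w ^ k, - (i * w ^ k)}) \<and>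
       mult_in \<zeta> (q * (q - 1)) i = (real q / real p) * ((real q - 1) / 2) \<and>
       mult_in \<zeta> (q * (q - 1)) (- i) = (real q / real p) * ((real q - 1) / 2) \<and>
       (\<forall>k\<in>{1..p - 1}.
          mult_in \<zeta> (q * (q - 1)) (i * w ^ k)
            = (real q / real p + real_of_int (Legendre (int k) (int p)) * sqrt (real q / real p))
              * ((real q - 1) / 2) \<and>
          mult_in \<zeta> (q * (q - 1)) (- (i * w ^ k))
            = (real q / real p - real_of_int (Legendre (int k) (int p)) * sqrt (real q / real p))
              * ((real q - 1) / 2))"
      using c M1 M1[of 0] \<open>p > 1\<close> legendre_0 by auto
  qed
qed

end
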